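(* For every integer $d \geq 2$, there exists an algorithm for the problem $\mathrm{Schrijver}(n,k,m)$ (in the black-box input model) with $m < d \cdot \left\lfloor \frac{n}{2k+d-2} \right\rfloor$ whose running time is $n^{O(d)}$.
   Context: Write $[n]=\{1,2,\ldots,n\}$. A subset of $[n]$ is called stable if it contains no two consecutive elements and does not contain both $1$ and $n$ (equivalently, it is an independent set in the cycle on vertex set $[n]$ with the natural cyclic order). Let $\binom{[n]}{k}_{\mathrm{stab}}$ denote the family of stable $k$-subsets of $[n]$. For positive integers $n \geq 2k$, the Schrijver graph $S(n,k)$ has vertex set $\binom{[n]}{k}_{\mathrm{stab}}$, with two sets adjacent if and only if they are disjoint. For a function $m=m(n,k)$, the search problem $\mathrm{Schrijver}(n,k,m)$ is: the input consists of positive integers $n,k$ with $n\geq 2k$ and a coloring $c:\binom{[n]}{k}_{\mathrm{stab}} \to [m]$ (not necessarily proper) with $m=m(n,k)$ colors; the goal is to find a monochromatic edge of $S(n,k)$, i.e., $A,B\in\binom{[n]}{k}_{\mathrm{stab}}$ with $A\cap B=\emptyset$ and $c(A)=c(B)$. In the black-box input model, the coloring $c$ is given by an oracle which, given a vertex $A$, returns $c(A)$; each oracle query counts as a step of the running time. *)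

theory Defs
  imports Complex_Main "HOL-Library.Landau_Symbols"
begin

section \<open>Schrijver graphs\<close>

definition stable :: "nat \<Rightarrow> nat set \<Rightarrow> bool" where
  "stable n A \<longleftrightarrow> A \<subseteq> {1..n} \<and> (\<forall>i. \<not> (i \<in> A \<and> Suc i \<in> A)) \<and> \<not> (1 \<in> A \<and> n \<in> A)"

definition schrijver_verts :: "nat \<Rightarrow> nat \<Rightarrow> nat set set" where
  "schrijver_verts n k = {A. stable n A \<and> card A = k}"

definition schrijver_adj :: "nat \<Rightarrow> nat \<Rightarrow> nat set \<Rightarrow> nat set \<Rightarrow> bool" where
  "schrijver_adj n k A B \<longleftrightarrow>
     A \<in> schrijver_verts n k \<and> B \<in> schrijver_verts n k \<and> A \<inter> B = {}"

text \<open>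
  A coloring is a partial function whose domain is exactly the vertex set, so that
  nothing at all can be learned from it about other sets.
\<close>

type_synonym coloring = "nat set \<rightharpoonup> nat"

definition schrijver_instance ::
    "(nat \<Rightarrow> nat \<Rightarrow> nat) \<Rightarrow> nat \<Rightarrow> nat \<Rightarrow> coloring \<Rightarrow> bool" where
  "schrijver_instance m n k c \<longleftrightarrow>
     0 < n \<and> 0 < k \<and> 2 * k \<le> n \<and> dom c = schrijver_verts n k \<and> ran c \<subseteq> {1..m n k}"

definition monochromatic_edge ::
    "nat \<Rightarrow> nat \<Rightarrow> coloring \<Rightarrow> nat set \<Rightarrow> nat set \<Rightarrow> bool" where
  "monochromatic_edge n k c A B \<longleftrightarrow> schrijver_adj n k A B \<and> c A = c B"


section \<open>Algorithms with oracle access to a coloring\<close>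

text \<open>
  Algorithms are programs of a unit-cost random access machine with structured control
  flow. A state consists of registers and of a memory with indirect addressing; every
  cell holds a natural number. The only arithmetic operations are addition and truncated
  subtraction. Without multiplication, numbers have at most linearly many bits in the
  number of steps, so unit cost agrees with Turing machine time up to a polynomial.
\<close>

type_synonym reg = string
type_synonym state = "(reg \<Rightarrow> nat) \<times> (nat \<Rightarrow> nat)"

datatype operand = Reg reg | Imm nat

fun opval :: "operand \<Rightarrow> (reg \<Rightarrow> nat) \<Rightarrow> nat" where
  "opval (Reg x) r = r x"
| "opval (Imm a) r = a"

datatype program =
    Move reg operand
  | Add reg operand operand
  | Sub reg operand operand
  | Load reg operand
  | Store operand operand
  | Query reg operand operand
  | Seq program program
  | Cond operand program program
  | Loop operand program

definition cells :: "(nat \<Rightarrow> nat) \<Rightarrow> nat \<Rightarrow> nat \<Rightarrow> nat set" where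
  "cells h a l = h ` {a..<a + l}"

text \<open>
  \<open>exec c p s t s'\<close>: with oracle \<open>c\<close>, program \<open>p\<close> started in state \<open>s\<close> halts after
  exactly \<open>t\<close> steps in state \<open>s'\<close>. Conditions test for being nonzero, and each test is a
  step. \<open>Query x a l\<close> asks the oracle about the set of the numbers stored in the \<open>l\<close>
  memory cells from address \<open>a\<close> on; this is one step. If this set is not a vertex, the
  program is stuck, hence does not halt.
\<close>

inductive exec :: "coloring \<Rightarrow> program \<Rightarrow> state \<Rightarrow> nat \<Rightarrow> state \<Rightarrow> bool"
  for c :: coloring where
  Move: "exec c (Move x a) (r, h) 1 (r(x := opval a r), h)"
| Add: "exec c (Add x a b) (r, h) 1 (r(x := opval a r + opval b r), h)"
| Sub: "exec c (Sub x a b) (r, h) 1 (r(x := opval a r - opval b r), h)"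
| Load: "exec c (Load x a) (r, h) 1 (r(x := h (opval a r)), h)"
| Store: "exec c (Store a b) (r, h) 1 (r, h(opval a r := opval b r))"
| Query: "c (cells h (opval a r) (opval l r)) = Some v \<Longrightarrow>
    exec c (Query x a l) (r, h) 1 (r(x := v), h)"
| Seq: "exec c p s t s' \<Longrightarrow> exec c q s' u s'' \<Longrightarrow> exec c (Seq p q) s (t + u) s''"
| CondTrue: "opval a r \<noteq> 0 \<Longrightarrow> exec c p (r, h) t s' \<Longrightarrow> exec c (Cond a p q) (r, h) (Suc t) s'"
| CondFalse: "opval a r = 0 \<Longrightarrow> exec c q (r, h) t s' \<Longrightarrow> exec c (Cond a p q) (r, h) (Suc t) s'"
| LoopFalse: "opval a r = 0 \<Longrightarrow> exec c (Loop a p) (r, h) 1 (r, h)"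
| LoopTrue: "opval a r \<noteq> 0 \<Longrightarrow> exec c p (r, h) t s' \<Longrightarrow> exec c (Loop a p) s' u s'' \<Longrightarrow>
    exec c (Loop a p) (r, h) (Suc (t + u)) s''"

inductive_cases exec_MoveE: "exec c (Move x a) s t s'"
inductive_cases exec_AddE: "exec c (Add x a b) s t s'"
inductive_cases exec_SubE: "exec c (Sub x a b) s t s'"
inductive_cases exec_LoadE: "exec c (Load x a) s t s'"
inductive_cases exec_StoreE: "exec c (Store a b) s t s'"
inductive_cases exec_QueryE: "exec c (Query x a l) s t s'"
inductive_cases exec_SeqE: "exec c (Seq p q) s t s'"
inductive_cases exec_CondE: "exec c (Cond a p q) s t s'"
inductive_cases exec_LoopE: "exec c (Loop a p) s t s'"

lemma exec_deterministic:
  "exec c p s t s' \<Longrightarrow> exec c p s u s'' \<Longrightarrow> u = t \<and> s'' = s'"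
proof (induction arbitrary: u s'' rule: exec.induct)
  case (Move x a r h)
  then show ?case by (auto elim: exec_MoveE)
next
  case (Add x a b r h)
  then show ?case by (auto elim: exec_AddE)
next
  case (Sub x a b r h)
  then show ?case by (auto elim: exec_SubE)
next
  case (Load x a r h)
  then show ?case by (auto elim: exec_LoadE)
next
  case (Store a b r h)
  then show ?case by (auto elim: exec_StoreE)
next
  case (Query h a r l v x)
  then show ?case by (auto elim: exec_QueryE)
next
  case (Seq p s t s' q t' s2)
  from Seq.prems show ?case
  proof (rule exec_SeqE)
    fix t1 s1 t2
    assume *: "u = t1 + t2" "exec c p s t1 s1" "exec c q s1 t2 s''"
    from Seq.IH(1)[OF *(2)] have eq: "t1 = t" "s1 = s'" by simp_all
    from Seq.IH(2)[OF *(3)[unfolded eq]] show ?thesis using * eq by simp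
  qed
next
  case (CondTrue a r p h t s' q)
  from CondTrue.prems show ?case
    by (rule exec_CondE) (use CondTrue.hyps in \<open>auto dest: CondTrue.IH\<close>)
next
  case (CondFalse a r q h t s' p)
  from CondFalse.prems show ?case
    by (rule exec_CondE) (use CondFalse.hyps in \<open>auto dest: CondFalse.IH\<close>)
next
  case (LoopFalse a r p h)
  from LoopFalse.prems show ?case
    by (rule exec_LoopE) (use LoopFalse.hyps in auto)
next
  case (LoopTrue a r p h t s' t' s2)
  from LoopTrue.prems show ?case
  proof (rule exec_LoopE)
    fix r' h' t1 s1 t2
    assume *: "(r, h) = (r', h')" "u = Suc (t1 + t2)"
      "exec c p (r', h') t1 s1" "exec c (Loop a p) s1 t2 s''"
    from LoopTrue.IH(1)[OF *(3)[folded *(1)]] have eq: "t1 = t" "s1 = s'" by simp_all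
    from LoopTrue.IH(2)[OF *(4)[unfolded eq]] show ?thesis using * eq by simp
  qed (use LoopTrue.hyps in auto)
qed

definition init_state :: "nat \<Rightarrow> nat \<Rightarrow> state" where
  "init_state n k = ((\<lambda>_. 0)(''n'' := n, ''k'' := k), \<lambda>_. 0)"

text \<open>
  The output is the pair of the sets stored in the \<open>k\<close> memory cells from the addresses
  in the registers \<open>A\<close> and \<open>B\<close> on.
\<close>

definition result_sets :: "nat \<Rightarrow> state \<Rightarrow> nat set \<times> nat set" where
  "result_sets k s = (cells (snd s) (fst s ''A'') k, cells (snd s) (fst s ''B'') k)"

definition finds_monochromatic_edge ::
    "program \<Rightarrow> nat \<Rightarrow> nat \<Rightarrow> coloring \<Rightarrow> nat \<Rightarrow> bool" where
  "finds_monochromatic_edge p n k c T \<longleftrightarrow>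
     (\<exists>t s A B. exec c p (init_state n k) t s \<and> t \<le> T \<and>
        result_sets k s = (A, B) \<and> monochromatic_edge n k c A B)"

end

(*
  Split [n] into n div (2k+d-2) intervals. On each of them the stable k-sets form a copy of the
  Schrijver graph S(2k+d-2, k), whose chromatic number is d. Fewer than d * (n div (2k+d-2))
  colors therefore leave a monochromatic edge inside one interval or two equally colored vertices
  in different intervals. A stable k-set inside an interval of that length is determined by its
  minimum and by the at most d-2 positions at which its gaps exceed 2, so that nested loops over
  2(d-1) numbers below n reach all pairs of such sets.

  The chromatic number bound follows from the octahedral Tucker lemma, applied to the labelling
  of a sign vector by the length of its longest alternating subsequence if that is less than 2k,
  and otherwise by the largest color of a stable k-set inside its positive or negative part. The
  Tucker lemma is proved by Ky Fan's parity argument: chains of faces are signed permutations,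
  and exchanging adjacent entries or negating the last one pairs up the chains that share a facet.
*)

theory Submission
  imports Defs
begin


section \<open>Alternating sets of labels\<close>

text \<open>Stable sets in different intervals are disjoint, so a color shared by two intervals
  already yields an edge; without an edge the palettes of the intervals are disjoint and have
  \<open>d\<close> colors each. The parity argument is an induction on dimension: in one hemisphere
  only facets on the equator escape the pairing, and the antipodal map trades negatively alternating
  chains of the hemisphere for positively alternating ones outside it. The labelling changes at
  \<open>2 * k\<close> because an alternating list of that length has stable \<open>k\<close>-sets
  in both sign parts. Being disjoint, these differ in color, so the larger color rank is at least 1;
  this is the color that is gained. Two features of the setting shape the program. A query about a
  non-vertex never returns, so membership is checked by arithmetic first. The time bound is a bare
  power of \<open>n\<close>, so constants and \<open>d\<close> must be absorbed by
  \<open>2 \<le> n\<close> and \<open>d \<le> n\<close>; the latter holds because at least one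
  interval has to fit.\<close>

fun alternates :: "bool \<Rightarrow> int list \<Rightarrow> bool" where
  "alternates s [] = True"
| "alternates s (x # xs) = ((if s then 0 < x else x < 0) \<and> alternates (\<not> s) xs)"

abbreviation abs_sorted :: "int list \<Rightarrow> bool" where
  "abs_sorted \<equiv> sorted_wrt (\<lambda>x y. \<bar>x\<bar> < \<bar>y\<bar>)"

text \<open>A chain of faces orders its labels by inclusion of the faces, but Fan's condition orders
  them by absolute value; hence a property of the set of labels.\<close>

definition alternating :: "bool \<Rightarrow> int set \<Rightarrow> bool" where
  "alternating s S \<longleftrightarrow> (\<exists>ys. abs_sorted ys \<and> alternates s ys \<and> set ys = S)"

lemma alternates_not_both: "alternates s xs \<Longrightarrow> alternates (\<not> s) xs \<Longrightarrow> xs = []"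
  by (cases xs) (auto split: if_splits)

lemma alternates_map_uminus [simp]: "alternates s (map uminus xs) = alternates (\<not> s) xs"
  by (induction xs arbitrary: s) auto

lemma abs_sorted_map_uminus [simp]: "abs_sorted (map uminus xs) = abs_sorted xs"
  by (simp add: sorted_wrt_map)

lemma alternating_uminus [simp]: "alternating s (uminus ` S) = alternating (\<not> s) S"
proof -
  have *: "alternating s (uminus ` S)" if "alternating (\<not> s) S" for s S
  proof -
    from that obtain ys where "abs_sorted ys" "alternates (\<not> s) ys" "set ys = S"
      by (auto simp: alternating_def)
    then show ?thesis
      unfolding alternating_def by (intro exI[of _ "map uminus ys"]) simp
  qed
  show ?thesis
    using *[of s S] *[of "\<not> s" "uminus ` S"] by (auto simp: image_image)
qed

lemma abs_sorted_unique:
  assumes "abs_sorted xs" "abs_sorted ys" "set xs = set ys"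
  shows "xs = ys"
proof -
  have inj: "inj_on abs (set xs)" if "abs_sorted xs" for xs :: "int list"
    using that by (induction xs) auto
  have "sorted (map abs zs) \<and> distinct (map abs zs)" if "abs_sorted zs" for zs :: "int list"
    using that by (induction zs) (auto simp: less_imp_le)
  then have "map abs xs = map abs ys"
    using assms by (intro sorted_distinct_set_unique) auto
  then show ?thesis
    using inj[OF assms(1)] assms(3) by (metis Un_absorb map_inj_on)
qed

lemma abs_sorted_exists:
  assumes "finite S" "inj_on abs S"
  shows "\<exists>ws :: int list. abs_sorted ws \<and> set ws = S"
proof -
  let ?ws = "sort_key abs (sorted_list_of_set S)"
  have "set ?ws = S" using assms by simp
  moreover have "sorted_wrt (<) (map abs ?ws)"
    using assms by (simp add: strict_sorted_iff distinct_map)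
  ultimately show ?thesis
    unfolding sorted_wrt_map by blast
qed

text \<open>If \<open>ws\<close> alternates from sign \<open>s\<close>, only deleting the last entry
  works; if it alternates from the other sign, only deleting the first. Otherwise a successful
  deletion removes one of two neighbors of equal sign, and removing the other works as well, so the
  number is 0 or 2.\<close>

lemma odd_deletions_alternate:
  assumes "ws \<noteq> []" "0 \<notin> set ws"
  shows "odd (card {j. j < length ws \<and> alternates s (take j ws @ drop (Suc j) ws)})
    \<longleftrightarrow> alternates s ws \<or> alternates (\<not> s) ws"
  using assms
proof (induction ws arbitrary: s)
  case Nil then show ?case by simp
next
  case (Cons a w)
  let ?D = "\<lambda>s w. {j. j < length w \<and> alternates s (take j w @ drop (Suc j) w)}"
  let ?pos = "if s then 0 < a else a < 0"
  \<comment> \<open>Deleting the head leaves \<open>w\<close>. Any later deletion keeps the head,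
    whose sign must then fit, and leaves a deletion from \<open>w\<close> for the opposite
    sign.\<close>
  have eq: "?D s (a # w) = (if alternates s w then {0} else {}) \<union>
      Suc ` (if ?pos then ?D (\<not> s) w else {})"
  proof -
    have "j \<in> ?D s (a # w) \<longleftrightarrow> j \<in> (if alternates s w then {0} else {}) \<union>
      Suc ` (if ?pos then ?D (\<not> s) w else {})" for j
      by (cases j) auto
    then show ?thesis by blast
  qed
  have card: "card (?D s (a # w)) = (if alternates s w then 1 else 0) +
      (if ?pos then card (?D (\<not> s) w) else 0)"
    unfolding eq by (subst card_Un_disjoint) (auto simp: card_image)
  have neg: "\<not> ?pos \<longleftrightarrow> (if \<not> s then 0 < a else a < 0)" using Cons.prems by auto
  show ?case
  proof (cases "w = []")
    case True
    then show ?thesis using card neg Cons.prems by auto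
  next
    case False
    have IH: "odd (card (?D (\<not> s) w)) \<longleftrightarrow> alternates (\<not> s) w \<or> alternates s w"
      using Cons.IH[of "\<not> s"] False Cons.prems by simp
    have "\<not> (alternates s w \<and> alternates (\<not> s) w)"
      using alternates_not_both False by blast
    then show ?thesis unfolding card using IH neg by auto
  qed
qed

lemma odd_removals_alternating:
  assumes "finite S" "S \<noteq> {}" and compl: "\<And>x. x \<in> S \<Longrightarrow> - x \<notin> S"
  shows "odd (card {x \<in> S. alternating s (S - {x})})
    \<longleftrightarrow> alternating s S \<or> alternating (\<not> s) S"
proof -
  have "inj_on abs S"
    using compl by (intro inj_onI) (metis abs_eq_iff)
  then obtain ws where ws: "abs_sorted ws" "set ws = S"
    using abs_sorted_exists[OF assms(1)] by blast
  have nz: "0 \<notin> set ws" using compl[of 0] ws(2) by auto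
  have ne: "ws \<noteq> []" using ws(2) assms(2) by auto
  have dist: "distinct ws" using ws(1) by (induction ws) auto
  have alt: "alternating s S \<longleftrightarrow> alternates s ws" for s
    unfolding alternating_def using ws abs_sorted_unique by metis
  have del: "alternating s (S - {ws ! j}) \<longleftrightarrow> alternates s (take j ws @ drop (Suc j) ws)"
    if "j < length ws" for j
  proof -
    have split: "ws = take j ws @ ws ! j # drop (Suc j) ws"
      using that by (rule id_take_nth_drop)
    have sorted: "abs_sorted (take j ws @ drop (Suc j) ws)"
      using ws(1) by (subst (asm) split) (auto simp: sorted_wrt_append)
    have "set (take j ws @ drop (Suc j) ws) = S - {ws ! j}"
    proof -
      have "distinct (take j ws @ ws ! j # drop (Suc j) ws)" using dist split by simp
      moreover have "S = set (take j ws @ ws ! j # drop (Suc j) ws)" using ws(2) split by simp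
      ultimately show ?thesis by auto
    qed
    then show ?thesis
      unfolding alternating_def using sorted abs_sorted_unique by metis
  qed
  have "{x \<in> S. alternating s (S - {x})} =
      (\<lambda>j. ws ! j) ` {j. j < length ws \<and> alternates s (take j ws @ drop (Suc j) ws)}"
    using del ws(2) by (auto simp: in_set_conv_nth)
  moreover have "inj_on (\<lambda>j. ws ! j) {j. j < length ws \<and> alternates s (take j ws @ drop (Suc j) ws)}"
    using dist by (auto simp: inj_on_def nth_eq_iff_index_eq)
  ultimately have "card {x \<in> S. alternating s (S - {x})} =
      card {j. j < length ws \<and> alternates s (take j ws @ drop (Suc j) ws)}"
    by (simp add: card_image)
  then show ?thesis using odd_deletions_alternate[OF ne nz] alt by simp
qed

text \<open>The local count of Fan's argument. For injective labels, dropping an index drops a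
  label. If \<open>f a = f b\<close> with \<open>a \<noteq> b\<close>, a facet with distinct labels
  must drop \<open>a\<close> or \<open>b\<close>, and both choices leave the same labels, so the
  count is 0 or 2.\<close>

lemma odd_facets_alternating:
  fixes f :: "nat \<Rightarrow> int"
  assumes I: "finite I" "I \<noteq> {}"
    and compl: "\<And>i j. i \<in> I \<Longrightarrow> j \<in> I \<Longrightarrow> f i \<noteq> - f j"
  shows "odd (card {j \<in> I. inj_on f (I - {j}) \<and> alternating s (f ` (I - {j}))}) \<longleftrightarrow>
    inj_on f I \<and> (alternating s (f ` I) \<or> alternating (\<not> s) (f ` I))"
proof (cases "inj_on f I")
  case True
  have im: "f ` (I - {j}) = f ` I - {f j}" if "j \<in> I" for j
    using True that by (auto simp: inj_on_def)
  have "f ` {j \<in> I. inj_on f (I - {j}) \<and> alternating s (f ` (I - {j}))} =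
      {x \<in> f ` I. alternating s (f ` I - {x})}"
    using im inj_on_subset[OF True] by auto
  moreover have "inj_on f {j \<in> I. inj_on f (I - {j}) \<and> alternating s (f ` (I - {j}))}"
    using True by (rule inj_on_subset) auto
  ultimately have "card {j \<in> I. inj_on f (I - {j}) \<and> alternating s (f ` (I - {j}))} =
      card {x \<in> f ` I. alternating s (f ` I - {x})}"
    using card_image[of f "{j \<in> I. inj_on f (I - {j}) \<and> alternating s (f ` (I - {j}))}"] by simp
  moreover have "- x \<notin> f ` I" if "x \<in> f ` I" for x
  proof
    assume "- x \<in> f ` I"
    with that obtain i j where "i \<in> I" "j \<in> I" "x = f i" "- x = f j" by blast
    then show False using compl[of j i] by simp
  qed
  then have "odd (card {x \<in> f ` I. alternating s (f ` I - {x})}) \<longleftrightarrow>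
      alternating s (f ` I) \<or> alternating (\<not> s) (f ` I)"
    using odd_removals_alternating[of "f ` I" s] I by blast
  ultimately show ?thesis
    using True by simp
next
  case False
  then obtain a b where ab: "a \<in> I" "b \<in> I" "a \<noteq> b" "f a = f b"
    by (auto simp: inj_on_def)
  let ?G = "\<lambda>j. inj_on f (I - {j}) \<and> alternating s (f ` (I - {j}))"
  have "f ` (I - {a}) = f ` (I - {b})"
  proof -
    have "f ` (I - {x}) = f ` I" if "x \<in> I" "y \<in> I" "x \<noteq> y" "f x = f y" for x y
    proof -
      have "f x \<in> f ` (I - {x})" using that by auto
      then show ?thesis using that(1) by (metis image_insert insert_Diff insert_absorb)
    qed
    then show ?thesis using ab by metis
  qed
  moreover from this have "inj_on f (I - {a}) \<longleftrightarrow> inj_on f (I - {b})"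
    using I(1) ab(1,2) by (simp add: inj_on_iff_eq_card)
  ultimately have iff: "?G a \<longleftrightarrow> ?G b" by simp
  have "j = a \<or> j = b" if "inj_on f (I - {j})" for j
    using that ab by (auto simp: inj_on_def)
  then have "{j \<in> I. ?G j} = (if ?G a then {a, b} else {})"
    using iff ab by auto
  then show ?thesis using False ab(3) by simp
qed

lemma even_card_involution:
  assumes "finite S" "\<And>x. x \<in> S \<Longrightarrow> \<phi> x \<in> S" "\<And>x. x \<in> S \<Longrightarrow> \<phi> (\<phi> x) = x"
    "\<And>x. x \<in> S \<Longrightarrow> \<phi> x \<noteq> x"
  shows "even (card S)"
  using assms
proof (induction "card S" arbitrary: S rule: less_induct)
  case less
  show ?case
  proof (cases "S = {}")
    case False
    then obtain x where x: "x \<in> S" by blast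
    let ?S = "S - {x, \<phi> x}"
    have sub: "{x, \<phi> x} \<subseteq> S" using x less.prems by auto
    have two: "card {x, \<phi> x} = 2" using less.prems(4)[OF x] by simp
    have card: "card ?S + 2 = card S"
      using sub two less.prems(1) by (metis card_Diff_subset card_mono finite_subset le_add_diff_inverse2)
    have "even (card ?S)"
    proof (rule less.hyps)
      show "card ?S < card S" using card by simp
      show "finite ?S" using less.prems by simp
      show "\<phi> y \<in> ?S" if "y \<in> ?S" for y
        using that less.prems x by (metis Diff_iff insert_iff singletonD)
    qed (use less.prems in auto)
    then show ?thesis using card by presburger
  qed simp
qed


section \<open>The octahedral Tucker lemma\<close>

text \<open>A nonzero vector over {+,-,0} is encoded by its signed nonzero positions. These are the
  nonempty boundary faces of the cross-polytope, and the antipodal map is the image under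
  \<open>uminus\<close>.\<close>

definition cube_faces :: "nat \<Rightarrow> int set set" where
  "cube_faces n = {X. X \<noteq> {} \<and> abs ` X \<subseteq> {1..int n} \<and> (\<forall>x\<in>X. - x \<notin> X)}"

text \<open>The facets of the barycentric subdivision of that boundary:
  \<open>set (take j xs)\<close> is the face with \<open>j\<close> vertices in the chain.\<close>

definition signed_perms :: "nat \<Rightarrow> int list set" where
  "signed_perms n = {xs. length xs = n \<and> abs ` set xs = {1..int n}}"

lemma finite_signed_perms [simp]: "finite (signed_perms n)"
proof -
  have "signed_perms n \<subseteq> {xs. set xs \<subseteq> {- int n..int n} \<and> length xs = n}"
    by (force simp: signed_perms_def abs_le_iff)
  then show ?thesis
    by (rule finite_subset) (simp add: finite_lists_length_eq)
qed

lemma signed_perms_distinct: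
  assumes "xs \<in> signed_perms n"
  shows "distinct xs" "inj_on abs (set xs)"
proof -
  have "card (set (map abs xs)) = length (map abs xs)"
    using assms by (simp add: signed_perms_def)
  then have "distinct (map abs xs)" by (rule card_distinct)
  then show "distinct xs" "inj_on abs (set xs)" by (auto simp: distinct_map)
qed

lemma signed_perms_no_opposite:
  assumes "xs \<in> signed_perms n" "x \<in> set xs"
  shows "- x \<notin> set xs"
proof
  assume "- x \<in> set xs"
  then have "x = - x"
    using inj_onD[OF signed_perms_distinct(2)[OF assms(1)], of x "- x"] assms(2) by simp
  then have "x = 0" by simp
  then show False using assms by (force simp: signed_perms_def)
qed

lemma set_take_signed_perm:
  assumes "xs \<in> signed_perms n" "j \<in> {1..n}"
  shows "set (take j xs) \<in> cube_faces n"
proof -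
  have "set (take j xs) \<subseteq> set xs" by (rule set_take_subset)
  moreover have "take j xs \<noteq> []" using assms by (auto simp: signed_perms_def)
  ultimately show ?thesis
    using assms(1) signed_perms_no_opposite[OF assms(1)]
    by (auto simp: cube_faces_def signed_perms_def)
qed

lemma cube_faces_mono: "n \<le> n' \<Longrightarrow> cube_faces n \<subseteq> cube_faces n'"
  by (force simp: cube_faces_def)

text \<open>Exchanging the 0-based positions \<open>j - 1\<close> and \<open>j\<close> changes only
  the prefix of length \<open>j\<close>, so \<open>j\<close> is also the index of the one face that
  is replaced.\<close>

definition swap_at :: "nat \<Rightarrow> int list \<Rightarrow> int list" where
  "swap_at j xs = xs[j - 1 := xs ! j, j := xs ! (j - 1)]"

lemma set_swap_take:
  assumes "1 \<le> j" "j < length xs" "i \<noteq> j"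
  shows "set (take i (swap_at j xs)) = set (take i xs)"
proof (cases "i < j")
  case True
  then show ?thesis by (simp add: swap_at_def)
next
  case False
  then have "take i (swap_at j xs) = (take i xs)[j - 1 := take i xs ! j, j := take i xs ! (j - 1)]"
    using assms by (simp add: swap_at_def take_update_swap)
  moreover have "j < length (take i xs)" using False assms by simp
  ultimately show ?thesis
    by (metis less_imp_diff_less set_swap)
qed

definition neg_at :: "nat \<Rightarrow> int list \<Rightarrow> int list" where
  "neg_at j xs = xs[j := - (xs ! j)]"

text \<open>With \<open>X = Y\<close>, \<open>no_complementary\<close> also excludes the label
  0.\<close>

locale antipodal_labelling =
  fixes lab :: "int set \<Rightarrow> int" and n :: nat
  assumes antipodal: "X \<in> cube_faces n \<Longrightarrow> lab (uminus ` X) = - lab X"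
    and no_complementary: "X \<in> cube_faces n \<Longrightarrow> Y \<in> cube_faces n \<Longrightarrow> X \<subseteq> Y \<Longrightarrow> lab X \<noteq> - lab Y"
begin

definition chain_labels :: "int list \<Rightarrow> nat \<Rightarrow> int" where
  "chain_labels xs j = lab (set (take j xs))"

definition alt_chain :: "bool \<Rightarrow> nat \<Rightarrow> int list \<Rightarrow> bool" where
  "alt_chain s i xs \<longleftrightarrow> inj_on (chain_labels xs) {1..i} \<and> alternating s (chain_labels xs ` {1..i})"

text \<open>Facets are counted for the positive initial sign only; the parity of this count detects
  the chains that alternate from either sign.\<close>

definition alt_facet :: "nat \<Rightarrow> int list \<Rightarrow> nat \<Rightarrow> bool" where
  "alt_facet i xs j \<longleftrightarrow> inj_on (chain_labels xs) ({1..i} - {j}) \<and>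
     alternating True (chain_labels xs ` ({1..i} - {j}))"

lemma alt_facet_cong:
  assumes "\<And>l. l \<in> {1..i} - {j} \<Longrightarrow> set (take l xs) = set (take l ys)"
  shows "alt_facet i xs j \<longleftrightarrow> alt_facet i ys j"
proof -
  have "chain_labels xs l = chain_labels ys l" if "l \<in> {1..i} - {j}" for l
    using assms[OF that] by (simp add: chain_labels_def)
  then show ?thesis
    unfolding alt_facet_def by (metis (no_types, lifting) image_cong inj_on_cong)
qed

lemma chain_labels_compl:
  assumes "xs \<in> signed_perms i" "i \<le> n" "a \<in> {1..i}" "b \<in> {1..i}"
  shows "chain_labels xs a \<noteq> - chain_labels xs b"
proof -
  have F: "set (take a xs) \<in> cube_faces n" "set (take b xs) \<in> cube_faces n"
    using set_take_signed_perm[OF assms(1)] assms cube_faces_mono[OF assms(2)] by blast+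
  show ?thesis
  proof (cases "a \<le> b")
    case True
    then show ?thesis
      using no_complementary[OF F set_take_subset_set_take] by (simp add: chain_labels_def)
  next
    case False
    then have "chain_labels xs b \<noteq> - chain_labels xs a"
      using no_complementary[OF F(2,1) set_take_subset_set_take] by (simp add: chain_labels_def)
    then show ?thesis by auto
  qed
qed

lemma alt_chain_uminus:
  assumes "xs \<in> signed_perms i" "i \<le> n"
  shows "alt_chain s i (map uminus xs) \<longleftrightarrow> alt_chain (\<not> s) i xs"
proof -
  have eq: "chain_labels (map uminus xs) j = - chain_labels xs j" if "j \<in> {1..i}" for j
    using antipodal[of "set (take j xs)"] set_take_signed_perm[OF assms(1) that]
      cube_faces_mono[OF assms(2)]
    by (auto simp: chain_labels_def take_map)
  have "chain_labels (map uminus xs) ` {1..i} = uminus ` chain_labels xs ` {1..i}"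
    using eq by (force simp: image_image)
  moreover have "inj_on (chain_labels (map uminus xs)) {1..i} \<longleftrightarrow> inj_on (chain_labels xs) {1..i}"
    using eq by (simp add: inj_on_def)
  ultimately show ?thesis by (simp add: alt_chain_def)
qed

text \<open>Double counting of the pairs of a chain in a hemisphere and a positively alternating
  facet of it. Facets in the interior cancel, those on the equator are counted by the induction
  hypothesis, so the hemisphere has an odd number of alternating chains of both signs
  together.\<close>

lemma odd_alt_chains: "i \<le> n \<Longrightarrow> odd (card {xs \<in> signed_perms i. alt_chain True i xs})"
proof (induction i)
  case 0
  have "{xs \<in> signed_perms 0. alt_chain True 0 xs} = {[]}"
    by (auto simp: signed_perms_def alt_chain_def alternating_def)
  then show ?case by simp
next
  case (Suc i)
  let ?N = "Suc i" and ?z = "int (Suc i)"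
  \<comment> \<open>A signed permutation contains exactly one of \<open>?z\<close> and
    \<open>- ?z\<close>, so \<open>H\<close> is a hemisphere, and negation exchanges it with its
    complement.\<close>
  define H where "H = {xs \<in> signed_perms ?N. - ?z \<notin> set xs}"
  have finH: "finite H" by (simp add: H_def)
  have len: "length xs = ?N" if "xs \<in> H" for xs using that by (simp add: H_def signed_perms_def)
  let ?AC = "\<lambda>s. {xs \<in> H. alt_chain s ?N xs}"

  have odd_iff: "odd (card {j \<in> {1..?N}. alt_facet ?N xs j}) \<longleftrightarrow> xs \<in> ?AC True \<union> ?AC False"
    if "xs \<in> H" for xs
    unfolding alt_facet_def
    using odd_facets_alternating[of "{1..?N}" "chain_labels xs" True] that Suc.prems chain_labels_compl
    by (auto simp: alt_chain_def H_def)

  \<comment> \<open>The exchange replaces only the face that this facet omits, and it keeps the set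
    of entries and hence membership in \<open>H\<close>.\<close>
  have even_swap: "even (card {xs \<in> H. alt_facet ?N xs j})" if "j \<in> {1..i}" for j
  proof (rule even_card_involution[where \<phi> = "swap_at j"])
    fix xs assume xs: "xs \<in> {xs \<in> H. alt_facet ?N xs j}"
    have j: "1 \<le> j" "j < length xs" using that xs len by auto
    have set: "set (swap_at j xs) = set xs" and length: "length (swap_at j xs) = length xs"
      using j by (simp_all add: swap_at_def set_swap)
    have "alt_facet ?N (swap_at j xs) j \<longleftrightarrow> alt_facet ?N xs j"
      by (rule alt_facet_cong) (use set_swap_take[OF j] in auto)
    then show "swap_at j xs \<in> {xs \<in> H. alt_facet ?N xs j}"
      using xs set length by (simp add: H_def signed_perms_def)
    show "swap_at j (swap_at j xs) = xs"
      using j by (intro nth_equalityI) (auto simp: swap_at_def nth_list_update)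
    have "distinct xs" using xs signed_perms_distinct by (auto simp: H_def)
    then have "xs ! j \<noteq> xs ! (j - 1)" using j by (simp add: nth_eq_iff_index_eq)
    then show "swap_at j xs \<noteq> xs" using j by (metis (no_types, lifting) length_list_update nth_list_update_eq swap_at_def)
  qed (simp add: finH)

  \<comment> \<open>Omitting the largest face leaves the sign of the last entry free. Negating it
    stays inside \<open>H\<close> unless this entry is \<open>?z\<close>.\<close>
  have "even (card {xs \<in> H. alt_facet ?N xs ?N \<and> xs ! i \<noteq> ?z})"
  proof (rule even_card_involution[where \<phi> = "neg_at i"])
    fix xs assume xs: "xs \<in> {xs \<in> H. alt_facet ?N xs ?N \<and> xs ! i \<noteq> ?z}"
    have l: "i < length xs" using xs len by auto
    have sp: "xs \<in> signed_perms ?N" using xs by (simp add: H_def)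
    have nz: "xs ! i \<noteq> 0" 
      using signed_perms_no_opposite[OF sp, of "xs ! i"] nth_mem[OF l] by auto
    have split: "xs = take i xs @ [xs ! i]" using l len xs by (simp add: take_Suc_conv_app_nth[symmetric])
    have neg: "neg_at i xs = take i xs @ [- (xs ! i)]"
      using l len xs by (simp add: neg_at_def upd_conv_take_nth_drop)
    have set: "abs ` set (neg_at i xs) = abs ` set xs"
      by (subst split) (simp add: neg)
    have "- ?z \<notin> set (neg_at i xs)"
      using xs split by (auto simp: neg H_def dest: in_set_takeD)
    moreover have "alt_facet ?N (neg_at i xs) ?N \<longleftrightarrow> alt_facet ?N xs ?N"
      by (rule alt_facet_cong) (auto simp: neg_at_def)
    moreover have "neg_at i xs ! i \<noteq> ?z"
    proof -
      have "- ?z \<notin> set xs" using xs by (simp add: H_def)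
      then have "xs ! i \<noteq> - ?z" using nth_mem[OF l] by metis
      then show ?thesis using l by (simp add: neg_at_def)
    qed
    ultimately show "neg_at i xs \<in> {xs \<in> H. alt_facet ?N xs ?N \<and> xs ! i \<noteq> ?z}"
      using xs set by (simp add: H_def signed_perms_def neg_at_def)
    show "neg_at i (neg_at i xs) = xs" using l by (simp add: neg_at_def)
    show "neg_at i xs \<noteq> xs" using l nz by (metis neg_equal_zero neg_at_def nth_list_update_eq)
  qed (simp add: finH)
  \<comment> \<open>The equator: without the last entry \<open>?z\<close>, a maximal chain of the
    dimension below remains.\<close>
  moreover have "card {xs \<in> H. alt_facet ?N xs ?N \<and> xs ! i = ?z} =
      card {xs \<in> signed_perms i. alt_chain True i xs}"
  proof (rule bij_betw_same_card[of "\<lambda>ys. ys @ [?z]", symmetric])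
    have facet: "alt_facet ?N (ys @ [?z]) ?N \<longleftrightarrow> alt_chain True i ys" if "length ys = i" for ys
    proof -
      have "{1..?N} - {?N} = {1..i}" by auto
      moreover have "chain_labels (ys @ [?z]) l = chain_labels ys l" if "l \<in> {1..i}" for l
        using that \<open>length ys = i\<close> by (simp add: chain_labels_def)
      ultimately show ?thesis
        unfolding alt_facet_def alt_chain_def by (metis (no_types, lifting) image_cong inj_on_cong)
    qed
    have ins: "{1..?z} = insert ?z {1..int i}" by auto
    show "bij_betw (\<lambda>ys. ys @ [?z]) {xs \<in> signed_perms i. alt_chain True i xs}
       {xs \<in> H. alt_facet ?N xs ?N \<and> xs ! i = ?z}"
      unfolding bij_betw_def
    proof (intro conjI set_eqI iffI)
      show "inj_on (\<lambda>ys. ys @ [?z]) {xs \<in> signed_perms i. alt_chain True i xs}"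
        by (simp add: inj_on_def)
    next
      fix xs assume "xs \<in> (\<lambda>ys. ys @ [?z]) ` {xs \<in> signed_perms i. alt_chain True i xs}"
      then obtain ys where ys: "xs = ys @ [?z]" "ys \<in> signed_perms i" "alt_chain True i ys" by blast
      have "abs ` set ys = {1..int i}" "length ys = i" using ys(2) by (auto simp: signed_perms_def)
      moreover from this have "- ?z \<notin> set ys" by force
      moreover have "xs \<in> signed_perms ?N"
        using calculation by (auto simp: signed_perms_def ys(1) ins)
      ultimately show "xs \<in> {xs \<in> H. alt_facet ?N xs ?N \<and> xs ! i = ?z}"
        using ys facet by (auto simp: H_def nth_append)
    next
      fix xs assume xs: "xs \<in> {xs \<in> H. alt_facet ?N xs ?N \<and> xs ! i = ?z}"
      then have l: "length xs = ?N" using len by simp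
      define ys where "ys = take i xs"
      have eq: "xs = ys @ [?z]" using l xs by (metis (mono_tags, lifting) lessI mem_Collect_eq take_Suc_conv_app_nth take_all_iff order_refl ys_def)
      have sp: "xs \<in> signed_perms ?N" using xs by (simp add: H_def)
      have "?z \<notin> abs ` set ys"
      proof -
        have "distinct (map abs xs)"
          using signed_perms_distinct[OF sp] by (simp add: distinct_map)
        then show ?thesis by (simp add: eq)
      qed
      moreover have "insert ?z (abs ` set ys) = insert ?z {1..int i}"
        using sp unfolding ins[symmetric] by (simp add: signed_perms_def eq)
      moreover have "?z \<notin> {1..int i}" by simp
      ultimately have "abs ` set ys = {1..int i}"
        by (metis insert_ident)
      then have "ys \<in> signed_perms i" using l by (simp add: signed_perms_def ys_def)
      moreover have "alt_chain True i ys" using facet[of ys] xs eq \<open>ys \<in> signed_perms i\<close>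
        by (simp add: signed_perms_def)
      ultimately show "xs \<in> (\<lambda>ys. ys @ [?z]) ` {xs \<in> signed_perms i. alt_chain True i xs}"
        using eq by blast
    qed
  qed
  moreover have "{xs \<in> H. alt_facet ?N xs ?N} = {xs \<in> H. alt_facet ?N xs ?N \<and> xs ! i \<noteq> ?z} \<union>
      {xs \<in> H. alt_facet ?N xs ?N \<and> xs ! i = ?z}" by auto
  then have "card {xs \<in> H. alt_facet ?N xs ?N} =
      card {xs \<in> H. alt_facet ?N xs ?N \<and> xs ! i \<noteq> ?z} + card {xs \<in> H. alt_facet ?N xs ?N \<and> xs ! i = ?z}"
    using finH by (simp only:) (subst card_Un_disjoint; auto)
  ultimately have odd_last: "odd (card {xs \<in> H. alt_facet ?N xs ?N})"
    using Suc by simp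

  have "(\<Sum>xs\<in>H. card {j \<in> {1..?N}. alt_facet ?N xs j}) =
      (\<Sum>j\<in>{1..?N}. card {xs \<in> H. alt_facet ?N xs j})"
    by (rule sum_multicount_gen) (use finH in auto)
  moreover have "odd (\<Sum>j\<in>{1..?N}. card {xs \<in> H. alt_facet ?N xs j})"
  proof -
    have "even (\<Sum>j\<in>{1..i}. card {xs \<in> H. alt_facet ?N xs j})"
      using even_swap by (rule dvd_sum)
    then show ?thesis using odd_last by simp
  qed
  moreover have "even (\<Sum>xs\<in>H. card {j \<in> {1..?N}. alt_facet ?N xs j}) \<longleftrightarrow>
      even (card {xs \<in> H. odd (card {j \<in> {1..?N}. alt_facet ?N xs j})})"
    by (rule even_sum_iff[OF finH])
  moreover have "{xs \<in> H. odd (card {j \<in> {1..?N}. alt_facet ?N xs j})} = ?AC True \<union> ?AC False"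
    using odd_iff by blast
  ultimately have "odd (card (?AC True \<union> ?AC False))" by simp
  \<comment> \<open>Negation carries the negatively alternating chains of \<open>H\<close> to the
    positively alternating chains outside \<open>H\<close>.\<close>
  moreover have "card {xs \<in> signed_perms ?N. alt_chain True ?N xs} = card (?AC True \<union> ?AC False)"
  proof -
    have disj: "?AC True \<inter> ?AC False = {}"
    proof -
      have False if "alt_chain True ?N xs" "alt_chain False ?N xs" for xs
      proof -
        from that obtain ys zs where "abs_sorted ys" "abs_sorted zs" "set ys = set zs"
          "alternates True ys" "alternates False zs" and ne: "set ys = chain_labels xs ` {1..?N}"
          by (auto simp: alt_chain_def alternating_def)
        moreover from this have "ys = zs" using abs_sorted_unique by blast
          ultimately have "ys = []" using alternates_not_both[of True ys] by simp
        then show False using ne by simp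
      qed
      then show ?thesis by blast
    qed
    let ?R = "{xs \<in> signed_perms ?N. - ?z \<in> set xs \<and> alt_chain True ?N xs}"
    have minus: "map uminus xs \<in> signed_perms ?N \<longleftrightarrow> xs \<in> signed_perms ?N" for xs
      by (simp add: signed_perms_def image_image)
    have "card (?AC False) = card ?R"
    proof (rule bij_betw_same_card[of "map uminus"], rule bij_betw_byWitness[where f' = "map uminus"])
      show "map uminus ` ?AC False \<subseteq> ?R"
      proof
        fix ys assume "ys \<in> map uminus ` ?AC False"
        then obtain xs where xs: "ys = map uminus xs" "xs \<in> signed_perms ?N" "- ?z \<notin> set xs"
          "alt_chain False ?N xs" by (auto simp: H_def)
        have "?z \<in> abs ` set xs" using xs(2) by (simp add: signed_perms_def)
        then obtain x where "x \<in> set xs" "?z = \<bar>x\<bar>" by blast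
        moreover from this have "x = ?z \<or> x = - ?z" by linarith
        ultimately have "?z \<in> set xs" using xs(3) by metis
        then have "- ?z \<in> set ys" unfolding xs(1) by force
        then show "ys \<in> ?R" using xs minus alt_chain_uminus[OF xs(2) Suc.prems] by simp
      qed
      show "map uminus ` ?R \<subseteq> ?AC False"
      proof
        fix ys assume "ys \<in> map uminus ` ?R"
        then obtain xs where xs: "ys = map uminus xs" "xs \<in> signed_perms ?N" "- ?z \<in> set xs"
          "alt_chain True ?N xs" by auto
        have "?z \<notin> set xs" using signed_perms_no_opposite[OF xs(2,3)] unfolding minus_minus .
        then have "- ?z \<notin> set ys"
          unfolding xs(1) set_map by (metis imageE neg_equal_iff_equal)
        then show "ys \<in> ?AC False" using xs minus alt_chain_uminus[OF xs(2) Suc.prems] by (simp add: H_def)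
      qed
    qed (auto simp: comp_def)
    moreover have "{xs \<in> signed_perms ?N. alt_chain True ?N xs} = ?AC True \<union> ?R"
      by (auto simp: H_def)
    moreover have "?AC True \<inter> ?R = {}" by (auto simp: H_def)
    ultimately show ?thesis
      using disj finH by (simp add: card_Un_disjoint)
  qed
  ultimately show ?case by simp
qed

text \<open>By parity some maximal chain alternates. Its \<open>n\<close> labels are distinct,
  nonzero and never opposite, so their absolute values are \<open>n\<close> distinct numbers between
  1 and \<open>m\<close>.\<close>

theorem octahedral_tucker:
  assumes "\<And>X. X \<in> cube_faces n \<Longrightarrow> \<bar>lab X\<bar> \<le> int m"
  shows "n \<le> m"
proof -
  have "{xs \<in> signed_perms n. alt_chain True n xs} \<noteq> {}"
    using odd_alt_chains[of n] by (metis card.empty even_zero order_refl)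
  then obtain xs where xs: "xs \<in> signed_perms n" "alt_chain True n xs" by blast
  let ?L = "chain_labels xs"
  have abs: "inj_on (\<lambda>j. \<bar>?L j\<bar>) {1..n}"
  proof (rule inj_onI)
    fix a b assume ab: "a \<in> {1..n}" "b \<in> {1..n}" "\<bar>?L a\<bar> = \<bar>?L b\<bar>"
    then have "?L a = ?L b"
      using chain_labels_compl[OF xs(1) order_refl ab(1,2)] by (auto simp: abs_eq_iff)
    then show "a = b" using xs(2) ab by (auto simp: alt_chain_def dest: inj_onD)
  qed
  have "(\<lambda>j. \<bar>?L j\<bar>) ` {1..n} \<subseteq> {1..int m}"
  proof
    fix v assume "v \<in> (\<lambda>j. \<bar>?L j\<bar>) ` {1..n}"
    then obtain j where j: "j \<in> {1..n}" "v = \<bar>?L j\<bar>" by blast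
    have "?L j \<noteq> 0" using chain_labels_compl[OF xs(1) order_refl j(1) j(1)] by auto
    moreover have "\<bar>?L j\<bar> \<le> int m"
      unfolding chain_labels_def by (rule assms) (rule set_take_signed_perm[OF xs(1) j(1)])
    ultimately show "v \<in> {1..int m}" using j by simp
  qed
  then have "card ((\<lambda>j. \<bar>?L j\<bar>) ` {1..n}) \<le> card {1..int m}" by (rule card_mono[rotated]) simp
  then show ?thesis unfolding card_image[OF abs] by simp
qed

end


section \<open>The chromatic number of Schrijver graphs\<close>

lemma finite_schrijver_verts [simp]: "finite (schrijver_verts n k)"
proof -
  have "schrijver_verts n k \<subseteq> Pow {1..n}" by (auto simp: schrijver_verts_def stable_def)
  then show ?thesis by (rule finite_subset) simp
qed

definition sign_part :: "bool \<Rightarrow> int set \<Rightarrow> nat set" where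
  "sign_part s X = {i. (if s then int i else - int i) \<in> X}"

lemma sign_part_uminus [simp]: "sign_part s (uminus ` X) = sign_part (\<not> s) X"
  by (force simp: sign_part_def image_iff)

lemma sign_part_mono: "X \<subseteq> Y \<Longrightarrow> sign_part s X \<subseteq> sign_part s Y"
  by (auto simp: sign_part_def)

lemma sign_part_disjoint:
  assumes "X \<in> cube_faces n"
  shows "sign_part s X \<inter> sign_part (\<not> s) X = {}"
  using assms by (cases s) (force simp: sign_part_def cube_faces_def)+

lemma alternates_nth:
  "alternates s ys \<Longrightarrow> i < length ys \<Longrightarrow> (if even i = s then 0 < ys ! i else ys ! i < 0)"
proof (induction ys arbitrary: s i)
  case (Cons y ys)
  then show ?case by (cases i) (fastforce split: if_splits)+
qed simp

text \<open>Between two entries of sign \<open>s\<close> lies one of the other sign, which makes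
  their gap at least 2. Among the first \<open>2 * k\<close> entries, the one at one of the two ends
  has the other sign, which keeps 1 and \<open>N\<close> from both being chosen.\<close>

lemma alternating_stable_sets:
  assumes ys: "abs_sorted ys" "alternates t ys" "2 * k \<le> length ys" "set ys \<subseteq> X"
    and X: "X \<in> cube_faces N"
  shows "\<exists>A \<in> schrijver_verts N k. A \<subseteq> sign_part s X"
proof -
  define off where "off = (if s = t then 0 else 1 :: nat)"
  define f where "f i = nat \<bar>ys ! (2 * i + off)\<bar>" for i
  have off: "off \<le> 1" by (simp add: off_def)
  have less: "\<bar>ys ! p\<bar> < \<bar>ys ! q\<bar>" if "p < q" "q < length ys" for p q
    using ys(1) that by (auto simp: sorted_wrt_iff_nth_less)
  have range: "\<bar>ys ! p\<bar> \<in> {1..int N}" if "p < length ys" for p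
  proof -
    have "ys ! p \<in> X" using ys(4) nth_mem[OF that] by blast
    then show ?thesis using X unfolding cube_faces_def by blast
  qed
  have idx: "2 * i + off < length ys" if "i < k" for i
    using that off ys(3) by linarith
  have f: "int (f i) = \<bar>ys ! (2 * i + off)\<bar>" for i by (simp add: f_def)
  have gap: "f i + 2 \<le> f j" if "i < j" "j < k" for i j
  proof -
    have "\<bar>ys ! (2 * i + off)\<bar> < \<bar>ys ! (2 * i + off + 1)\<bar>"
      using that idx[of j] by (intro less) auto
    moreover have "\<bar>ys ! (2 * i + off + 1)\<bar> < \<bar>ys ! (2 * j + off)\<bar>"
      using that idx[of j] by (intro less) auto
    ultimately have "int (f i) + 2 \<le> int (f j)"
      unfolding f by linarith
    then show ?thesis by linarith
  qed
  have inj: "inj_on f {..<k}"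
  proof (rule inj_onI)
    fix i j assume "i \<in> {..<k}" "j \<in> {..<k}" "f i = f j"
    then show "i = j" using gap[of i j] gap[of j i] by (cases i j rule: linorder_cases) auto
  qed
  have frange: "f i \<in> {1..N}" if "i < k" for i
    using range[OF idx[OF that]] f[of i] by auto
  have "stable N (f ` {..<k})"
    unfolding stable_def
  proof (intro conjI allI)
    show "f ` {..<k} \<subseteq> {1..N}" using frange by auto
    show "\<not> (i \<in> f ` {..<k} \<and> Suc i \<in> f ` {..<k})" for i
    proof
      assume "i \<in> f ` {..<k} \<and> Suc i \<in> f ` {..<k}"
      then obtain p q where "p < k" "q < k" "f q = Suc (f p)" by auto
      then show False using gap[of p q] gap[of q p] by (cases p q rule: linorder_cases) auto
    qed
    show "\<not> (1 \<in> f ` {..<k} \<and> N \<in> f ` {..<k})"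
    proof
      assume "1 \<in> f ` {..<k} \<and> N \<in> f ` {..<k}"
      then obtain p q where pq: "p < k" "q < k" "f p = 1" "f q = N" by auto
      show False
      \<comment> \<open>With offset 0 every chosen entry has a successor in the list and is below
        \<open>N\<close>; with offset 1 the entry at position 0 precedes all chosen ones, so they
        exceed 1.\<close>
      proof (cases "off = 0")
        case True
        then have "2 * q + off + 1 < length ys" using pq ys(3) by linarith
        then show False using range less[of "2 * q + off" "2 * q + off + 1"] f[of q] pq(4)
          by fastforce
      next
        case False
        then have "0 < 2 * p + off" by simp
        then show False using less[OF _ idx[OF pq(1)], of 0] range[of 0] idx[OF pq(1)] f[of p] pq(3)
          by fastforce
      qed
    qed
  qed
  then have "f ` {..<k} \<in> schrijver_verts N k"
    using inj by (simp add: schrijver_verts_def card_image)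
  moreover have "f i \<in> sign_part s X" if "i < k" for i
  proof -
    have mem: "ys ! (2 * i + off) \<in> X" using ys(4) nth_mem[OF idx[OF that]] by blast
    have "if s then 0 < ys ! (2 * i + off) else ys ! (2 * i + off) < 0"
      using alternates_nth[OF ys(2) idx[OF that]] by (auto simp: off_def split: if_splits)
    then have "(if s then int (f i) else - int (f i)) = ys ! (2 * i + off)"
      unfolding f by (cases s) simp_all
    then show ?thesis using mem by (simp add: sign_part_def)
  qed
  ultimately show ?thesis by (intro bexI[of _ "f ` {..<k}"] image_subsetI) auto
qed

section \<open>Longest alternating lists inside a sign vector\<close>

definition alt_length :: "bool \<Rightarrow> int set \<Rightarrow> nat" where
  "alt_length s X = Max (length ` {ys. abs_sorted ys \<and> alternates s ys \<and> set ys \<subseteq> X})"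

lemma finite_cube_face: "X \<in> cube_faces n \<Longrightarrow> finite X"
proof -
  assume "X \<in> cube_faces n"
  then have "X \<subseteq> {- int n..int n}" by (force simp: cube_faces_def abs_le_iff)
  then show "finite X" by (rule finite_subset) simp
qed

lemma finite_alt_lengths:
  assumes "finite X"
  shows "finite (length ` {ys. abs_sorted ys \<and> alternates s ys \<and> set ys \<subseteq> X})"
proof (rule finite_subset)
  show "length ` {ys. abs_sorted ys \<and> alternates s ys \<and> set ys \<subseteq> X} \<subseteq> {..card X}"
  proof clarify
    fix ys assume "abs_sorted ys" "set ys \<subseteq> X"
    moreover from this have "distinct ys" by (induction ys) auto
    ultimately show "length ys \<le> card X"
      using assms by (metis card_mono distinct_card)
  qed
qed simp

lemma alt_length_ge:
  assumes "finite X" "abs_sorted ys" "alternates s ys" "set ys \<subseteq> X"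
  shows "length ys \<le> alt_length s X"
  unfolding alt_length_def by (rule Max_ge[OF finite_alt_lengths[OF assms(1)]]) (use assms in auto)

lemma alt_length_attained:
  assumes "finite X"
  obtains ys where "abs_sorted ys" "alternates s ys" "set ys \<subseteq> X" "length ys = alt_length s X"
proof -
  have "alt_length s X \<in> length ` {ys. abs_sorted ys \<and> alternates s ys \<and> set ys \<subseteq> X}"
    unfolding alt_length_def
    by (rule Max_in[OF finite_alt_lengths[OF assms]]) (auto intro: exI[of _ "[]"])
  then show ?thesis using that by auto
qed

lemma alt_length_mono:
  assumes "finite Y" "X \<subseteq> Y"
  shows "alt_length s X \<le> alt_length s Y"
proof -
  obtain ys where "abs_sorted ys" "alternates s ys" "set ys \<subseteq> X" "length ys = alt_length s X"
    using alt_length_attained finite_subset[OF assms(2,1)] by blast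
  then show ?thesis using alt_length_ge[OF assms(1), of ys s] assms(2) by simp
qed

lemma alt_length_uminus [simp]:
  assumes "finite X"
  shows "alt_length s (uminus ` X) = alt_length (\<not> s) X"
proof (rule antisym)
  have *: "alt_length (\<not> s) X \<le> alt_length s (uminus ` X)" if fin: "finite X" for s X
  proof -
    obtain ys where ys: "abs_sorted ys" "alternates (\<not> s) ys" "set ys \<subseteq> X"
      "length ys = alt_length (\<not> s) X"
      using alt_length_attained[OF fin] by blast
    then show ?thesis
      using alt_length_ge[of "uminus ` X" "map uminus ys" s] fin by auto
  qed
  show "alt_length (\<not> s) X \<le> alt_length s (uminus ` X)" using * assms by blast
  show "alt_length s (uminus ` X) \<le> alt_length (\<not> s) X"
    using *[of "uminus ` X" "\<not> s"] assms by (simp add: image_image)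
qed

text \<open>Of two longest alternating lists with opposite initial signs, the one that starts
  further right could be prolonged by the first entry of the other.\<close>

lemma alt_length_neq:
  assumes "X \<in> cube_faces n"
  shows "alt_length s X \<noteq> alt_length (\<not> s) X"
proof
  assume eq: "alt_length s X = alt_length (\<not> s) X"
  have fin: "finite X" by (rule finite_cube_face[OF assms])
  obtain x where x: "x \<in> X" using assms by (auto simp: cube_faces_def)
  have "x \<noteq> 0" using assms x by (force simp: cube_faces_def)
  then have "alternates (0 < x) [x]" by auto
  then have "1 \<le> alt_length (0 < x) X" using alt_length_ge[OF fin, of "[x]"] x by simp
  then have pos: "1 \<le> alt_length s X" using eq by (cases "s = (0 < x)") auto
  have *: "alt_length b X < alt_length a X"
    if "abs_sorted zs" "alternates (\<not> a) zs" "set (y # zs) \<subseteq> X" "if a then 0 < y else y < 0"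
      "length zs = alt_length b X" "zs \<noteq> []" "\<bar>y\<bar> < \<bar>hd zs\<bar>" for y zs a b
  proof -
    have "abs_sorted (y # zs)"
      using that(1,6,7) by (cases zs) (auto intro: less_trans)
    then have "length (y # zs) \<le> alt_length a X"
      using that by (intro alt_length_ge[OF fin]) auto
    then show ?thesis using that(5) by simp
  qed
  obtain ys where ys: "abs_sorted ys" "alternates s ys" "set ys \<subseteq> X" "length ys = alt_length s X"
    using alt_length_attained[OF fin] by blast
  obtain zs where zs: "abs_sorted zs" "alternates (\<not> s) zs" "set zs \<subseteq> X"
      "length zs = alt_length (\<not> s) X"
    using alt_length_attained[OF fin] by blast
  obtain y ys' where y: "ys = y # ys'" using ys(4) pos by (cases ys) auto
  obtain z zs' where z: "zs = z # zs'" using zs(4) pos eq by (cases zs) auto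
  have signs: "if s then 0 < y else y < 0" "if s then z < 0 else 0 < z"
    using ys(2) zs(2) y z by (auto split: if_splits)
  have "\<bar>y\<bar> \<noteq> \<bar>z\<bar>"
  proof
    assume "\<bar>y\<bar> = \<bar>z\<bar>"
    then have "z = - y" using signs by (auto simp: abs_eq_iff split: if_splits)
    then show False using assms ys(3) zs(3) y z by (auto simp: cube_faces_def)
  qed
  then consider "\<bar>y\<bar> < \<bar>z\<bar>" | "\<bar>z\<bar> < \<bar>y\<bar>" by linarith
  then show False
  proof cases
    case 1
    then show False using *[of zs s y "\<not> s"] zs ys signs y z eq by (cases s) auto
  next
    case 2
    then show False using *[of ys "\<not> s" z s] zs ys signs y z eq by (cases s) auto
  qed
qed

text \<open>With \<open>e\<close> colors, the labelling built here takes absolute values up to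
  \<open>2 * k + e - 2\<close>, which the Tucker lemma forces to be at least
  \<open>N\<close>.\<close>

theorem schrijver_coloring_bound:
  fixes col :: "nat set \<Rightarrow> 'a"
  assumes k: "2 * k \<le> N"
    and proper: "\<And>A B. A \<in> schrijver_verts N k \<Longrightarrow> B \<in> schrijver_verts N k \<Longrightarrow>
      A \<inter> B = {} \<Longrightarrow> col A \<noteq> col B"
  shows "N + 2 \<le> 2 * k + card (col ` schrijver_verts N k)"
proof -
  let ?V = "schrijver_verts N k"
  \<comment> \<open>For \<open>k = 0\<close> the empty set is a vertex disjoint from itself, against
    \<open>proper\<close>.\<close>
  have kpos: "0 < k"
  proof (rule ccontr)
    assume "\<not> 0 < k"
    then have "{} \<in> ?V" by (simp add: schrijver_verts_def stable_def)
    then show False using proper[of "{}" "{}"] by simp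
  qed
  define e where "e = card (col ` ?V)"
  obtain g where g: "bij_betw g (col ` ?V) {0..<e}"
    unfolding e_def using ex_bij_betw_finite_nat[of "col ` ?V"] by auto
  define rank where "rank A = g (col A)" for A
  have rank_less: "rank A < e" if "A \<in> ?V" for A
    using bij_betwE[OF g] that by (simp add: rank_def)
  have rank_neq: "rank A \<noteq> rank B" if "A \<in> ?V" "B \<in> ?V" "A \<inter> B = {}" for A B
    using proper[OF that] g that by (auto simp: rank_def bij_betw_def inj_on_def)
  define R where "R s X = rank ` {A \<in> ?V. A \<subseteq> sign_part s X}" for s X
  define top where "top X = Max (R True X \<union> R False X)" for X
  define amax where "amax X = max (alt_length True X) (alt_length False X)" for X
  \<comment> \<open>Small labels end at \<open>2 * k - 1\<close> in absolute value; large ones begin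
    at \<open>2 * k\<close>, since \<open>top X\<close> is at least 1. The sign tells which initial
    sign gives the longer list, or which part attains \<open>top X\<close>;
    \<open>alt_length_neq\<close> and \<open>R_conflict\<close> exclude ties.\<close>
  define lab where "lab X = (if amax X < 2 * k
      then (if alt_length False X < alt_length True X then 1 else -1) * int (amax X)
      else (if top X \<in> R True X then 1 else -1) * (2 * int k - 1 + int (top X)))" for X
  have finR [simp]: "finite (R s X)" for s X by (simp add: R_def)
  have R_uminus: "R s (uminus ` X) = R (\<not> s) X" for s X by (simp add: R_def)
  have R_conflict: False if "Y \<in> cube_faces N" "X \<subseteq> Y" "v \<in> R s X" "v \<in> R (\<not> s) Y" for X Y v s
  proof -
    obtain A B where AB: "A \<in> ?V" "B \<in> ?V" "A \<subseteq> sign_part s X" "B \<subseteq> sign_part (\<not> s) Y" "rank A = rank B"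
      using \<open>v \<in> R s X\<close> \<open>v \<in> R (\<not> s) Y\<close> unfolding R_def by auto
    then have "A \<inter> B = {}"
      using sign_part_mono[OF that(2)] sign_part_disjoint[OF that(1), of s] by blast
    then show False using rank_neq AB by blast
  qed
  have R_ne: "R s X \<noteq> {}" if X: "X \<in> cube_faces N" "2 * k \<le> amax X" for X s
  proof -
    obtain t where "2 * k \<le> alt_length t X" using X(2)
      unfolding amax_def max_def by (auto split: if_splits)
    then obtain ys where "abs_sorted ys" "alternates t ys" "set ys \<subseteq> X" "alt_length t X = length ys"
      using alt_length_attained[OF finite_cube_face[OF X(1)], of t] by metis
    then obtain A where "A \<in> ?V" "A \<subseteq> sign_part s X"
      using alternating_stable_sets[of ys t k X N s] X(1) \<open>2 * k \<le> alt_length t X\<close> by auto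
    then show ?thesis by (auto simp: R_def)
  qed
  have top_in: "top X \<in> R True X \<union> R False X" if "X \<in> cube_faces N" "2 * k \<le> amax X" for X
    unfolding top_def using R_ne[OF that] by (intro Max_in) auto
  have top_range: "1 \<le> top X \<and> top X < e" if X: "X \<in> cube_faces N" "2 * k \<le> amax X" for X
  proof
    obtain a b where ab: "a \<in> R True X" "b \<in> R False X" using R_ne[OF X] by blast
    have "a \<noteq> b" using R_conflict[OF X(1) order_refl ab(1)] ab by auto
    moreover have "a \<le> top X" "b \<le> top X" unfolding top_def using ab by (auto intro: Max_ge)
    ultimately show "1 \<le> top X" by linarith
    show "top X < e" using top_in[OF X] rank_less by (auto simp: R_def)
  qed
  have amax_uminus: "amax (uminus ` X) = amax X" if "X \<in> cube_faces N" for X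
    using that finite_cube_face by (simp add: amax_def max.commute)
  have amax_pos: "0 < amax X" if "X \<in> cube_faces N" for X
    using alt_length_neq[OF that, of True] by (simp add: amax_def)
  interpret antipodal_labelling lab N
  proof
    fix X assume X: "X \<in> cube_faces N"
    show "lab (uminus ` X) = - lab X"
    proof (cases "amax X < 2 * k")
      case True
      then show ?thesis
        using alt_length_neq[OF X, of True] amax_uminus[OF X] finite_cube_face[OF X]
        by (auto simp: lab_def)
    next
      case False
      have "top (uminus ` X) = top X" by (simp add: top_def R_uminus Un_commute)
      moreover have "top X \<in> R False X \<longleftrightarrow> top X \<notin> R True X"
        using top_in[OF X] False R_conflict[OF X order_refl, of "top X" True] by auto
      ultimately show ?thesis
        using False amax_uminus[OF X] by (simp add: lab_def R_uminus)
    qed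
    fix Y assume Y: "Y \<in> cube_faces N" and XY: "X \<subseteq> Y"
    show "lab X \<noteq> - lab Y"
    proof
      assume eq: "lab X = - lab Y"
      have abs1: "\<bar>lab Z\<bar> = int (amax Z)" if "amax Z < 2 * k" for Z
        using that by (simp add: lab_def)
      have abs2: "\<bar>lab Z\<bar> = 2 * int k - 1 + int (top Z)" if "Z \<in> cube_faces N" "\<not> amax Z < 2 * k" for Z
        using that top_range[OF that(1)] by (simp add: lab_def)
      have abs_eq: "\<bar>lab X\<bar> = \<bar>lab Y\<bar>" using eq by simp
      consider "amax X < 2 * k" "amax Y < 2 * k" "amax X = amax Y"
        | "\<not> amax X < 2 * k" "\<not> amax Y < 2 * k" "top X = top Y"
      proof (cases "amax X < 2 * k"; cases "amax Y < 2 * k")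
        assume "amax X < 2 * k" "amax Y < 2 * k"
        then show thesis using that(1) abs_eq abs1 by simp
      next
        assume "amax X < 2 * k" "\<not> amax Y < 2 * k"
        then show thesis using abs_eq abs1[of X] abs2[OF Y] top_range[OF Y] by simp
      next
        assume "\<not> amax X < 2 * k" "amax Y < 2 * k"
        then show thesis using abs_eq abs1[of Y] abs2[OF X] top_range[OF X] by simp
      next
        assume "\<not> amax X < 2 * k" "\<not> amax Y < 2 * k"
        then show thesis using that(2) abs_eq abs2[OF X] abs2[OF Y] by simp
      qed
      then show False
      proof cases
        \<comment> \<open>The longer initial sign for \<open>X\<close> does at least as well in
          \<open>Y\<close>, where the opposite one is strictly better; so \<open>amax Y\<close>
          would exceed \<open>amax X\<close>.\<close>
        case 1
        have finY: "finite Y" by (rule finite_cube_face[OF Y])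
        have "alt_length True X \<le> alt_length True Y" "alt_length False X \<le> alt_length False Y"
          using alt_length_mono[OF finY XY] by auto
        moreover have "alt_length True X \<noteq> alt_length False X" "alt_length True Y \<noteq> alt_length False Y"
          using alt_length_neq[OF X, of True] alt_length_neq[OF Y, of True] by auto
        moreover have "(alt_length False X < alt_length True X) \<noteq> (alt_length False Y < alt_length True Y)"
          using eq 1 amax_pos[OF X] by (auto simp: lab_def split: if_splits)
        ultimately show False using 1(3) by (auto simp: amax_def max_def split: if_splits)
      next
        case 2
        \<comment> \<open>Opposite signs put the same rank into opposite parts of \<open>X\<close>
          and \<open>Y\<close>, that is, on two disjoint stable sets.\<close>
        have "0 < 2 * int k - 1 + int (top X)" using kpos by simp
        then have "(top X \<in> R True X) \<noteq> (top Y \<in> R True Y)"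
          using eq 2 by (auto simp: lab_def split: if_splits)
        then obtain s where "top X \<in> R s X" "top X \<in> R (\<not> s) Y"
          using top_in[OF X] top_in[OF Y] 2 by fastforce
        then show False using R_conflict[OF Y XY] by blast
      qed
    qed
  qed
  \<comment> \<open>The maximum keeps room for the small labels up to \<open>2 * k - 1\<close>
    without a proof that colors exist; \<open>2 * k \<le> N\<close> then rules out
    \<open>e \<le> 1\<close>.\<close>
  have "N \<le> 2 * k + max e 1 - 2"
  proof (rule octahedral_tucker)
    fix X assume X: "X \<in> cube_faces N"
    show "\<bar>lab X\<bar> \<le> int (2 * k + max e 1 - 2)"
    proof (cases "amax X < 2 * k")
      case True
      then have "\<bar>lab X\<bar> = int (amax X)" by (simp add: lab_def)
      then show ?thesis using True by linarith
    next
      case False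
      then have "\<bar>lab X\<bar> = 2 * int k - 1 + int (top X)" using kpos by (simp add: lab_def)
      then show ?thesis using top_range[OF X] False kpos by linarith
    qed
  qed
  then show ?thesis
    using k kpos unfolding e_def[symmetric] by linarith
qed


section \<open>Stable sets in short intervals\<close>

text \<open>Each entry \<open>q\<close> of the list enlarges the gap before the element with index \<open>q\<close> by 1: with
  truncated subtraction, its summand is 1 if \<open>q \<le> i\<close> and 0 otherwise.\<close>

definition spread :: "nat \<Rightarrow> nat list \<Rightarrow> nat \<Rightarrow> nat" where
  "spread a qs i = a + i + i + (\<Sum>q\<leftarrow>qs. 1 - (q - i))"

definition spread_set :: "nat \<Rightarrow> nat list \<Rightarrow> nat \<Rightarrow> nat set" where
  "spread_set a qs k = spread a qs ` {..<k}"

lemma spread_gap: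
  assumes "i < j"
  shows "spread a qs i + 2 \<le> spread a qs j"
proof -
  have "(\<Sum>q\<leftarrow>qs. 1 - (q - i)) \<le> (\<Sum>q\<leftarrow>qs. 1 - (q - j))"
    using assms by (intro sum_list_mono) simp
  then show ?thesis using assms unfolding spread_def by linarith
qed

text \<open>The last hypothesis bounds the span by \<open>n - 2\<close>, so 1 and \<open>n\<close>
  do not both occur. Membership thus reduces to tests on the least and the greatest element, which a
  program can perform.\<close>

lemma spread_set_vertex:
  assumes "0 < k" "1 \<le> a" "spread a qs (k - 1) \<le> n" "spread a qs (k - 1) + 2 \<le> n + spread a qs 0"
  shows "spread_set a qs k \<in> schrijver_verts n k"
proof -
  let ?f = "spread a qs"
  have "inj_on ?f {..<k}"
  proof (rule inj_onI)
    fix i j assume "?f i = ?f j"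
    then show "i = j" using spread_gap[of i j a qs] spread_gap[of j i a qs]
      by (cases i j rule: linorder_cases) auto
  qed
  moreover have mono: "?f i \<le> ?f j" if "i \<le> j" for i j
    using spread_gap[of i j a qs] that by (cases "i = j") auto
  have ge: "?f 0 \<le> ?f i" and le: "?f i \<le> ?f (k - 1)" if "i < k" for i
    using mono that by auto
  have "stable n (?f ` {..<k})"
    unfolding stable_def
  proof (intro conjI allI)
    have "1 \<le> ?f 0" using assms(2) by (simp add: spread_def)
    then show "?f ` {..<k} \<subseteq> {1..n}"
      using ge le assms(3) by (force intro: order_trans[of _ "?f 0"] order_trans[of _ "?f (k - 1)"])
    show "\<not> (i \<in> ?f ` {..<k} \<and> Suc i \<in> ?f ` {..<k})" for i
    proof
      assume "i \<in> ?f ` {..<k} \<and> Suc i \<in> ?f ` {..<k}"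
      then obtain p q where "?f q = Suc (?f p)" by (metis imageE)
      then show False using spread_gap[of p q a qs] spread_gap[of q p a qs]
        by (cases p q rule: linorder_cases) auto
    qed
    show "\<not> (1 \<in> ?f ` {..<k} \<and> n \<in> ?f ` {..<k})"
    proof
      assume "1 \<in> ?f ` {..<k} \<and> n \<in> ?f ` {..<k}"
      then obtain p q where "p < k" "q < k" "?f p = 1" "?f q = n" by auto
      then show False using ge[of p] le[of q] assms(4) by linarith
    qed
  qed
  ultimately show ?thesis by (simp add: schrijver_verts_def spread_set_def card_image)
qed

lemma spread_set_shift: "(\<lambda>x. x + s) ` spread_set a qs k = spread_set (a + s) qs k"
  by (simp add: spread_set_def image_image spread_def algebra_simps)

text \<open>The excess \<open>sl i\<close> of the element with index \<open>i\<close> over the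
  tightest packing is nondecreasing in \<open>i\<close> and at most \<open>D\<close>. The list
  \<open>qs\<close> is the conjugate of this partition: \<open>sl i\<close> is the number of
  \<open>j < D\<close> with \<open>q j \<le> i\<close>.\<close>

lemma schrijver_vert_spread:
  assumes A: "A \<in> schrijver_verts (2 * k + D) k" and k: "0 < k"
  obtains a qs where "A = spread_set a qs k" "length qs = D" "\<forall>q\<in>set qs. q \<le> k" "1 \<le> a"
    "spread a qs (k - 1) + 2 \<le> 2 * k + D + spread a qs 0"
proof -
  define xs where "xs = sorted_list_of_set A"
  have stable: "stable (2 * k + D) A" and card: "card A = k" using A by (auto simp: schrijver_verts_def)
  have fin: "finite A" using stable by (auto simp: stable_def intro: finite_subset)
  have set: "set xs = A" and len: "length xs = k" and sorted: "sorted_wrt (<) xs"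
    unfolding xs_def using fin card by auto
  have step: "xs ! i + 2 \<le> xs ! Suc i" if "Suc i < k" for i
  proof -
    have "xs ! i < xs ! Suc i" using sorted that len by (simp add: sorted_wrt_iff_nth_less)
    moreover have "xs ! i \<in> A" "xs ! Suc i \<in> A" using set len that by auto
    then have "xs ! Suc i \<noteq> Suc (xs ! i)" using stable by (metis stable_def)
    ultimately show ?thesis by linarith
  qed
  have gap: "xs ! i + 2 * l \<le> xs ! (i + l)" if "i + l < k" for i l
    using that
  proof (induction l)
    case (Suc l)
    then show ?case using step[of "i + l"] by simp
  qed simp
  define sl where "sl i = xs ! i - (xs ! 0 + 2 * i)" for i
  have sl: "xs ! i = xs ! 0 + 2 * i + sl i" if "i < k" for i
    using gap[of 0 i] that by (simp add: sl_def)
  have sl_mono: "sl i \<le> sl j" if "i \<le> j" "j < k" for i j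
    using gap[of i "j - i"] that sl[of i] sl[of j] by simp
  have in_A: "xs ! i \<in> A" if "i < k" for i using set len that by auto
  have first: "1 \<le> xs ! 0" using in_A[of 0] stable k by (auto simp: stable_def)
  have last: "xs ! (k - 1) \<le> 2 * k + D" using in_A[of "k - 1"] stable k by (auto simp: stable_def)
  have span: "xs ! (k - 1) + 2 \<le> 2 * k + D + xs ! 0"
  proof (cases "xs ! 0 = 1")
    case True
    then have "xs ! (k - 1) \<noteq> 2 * k + D"
      using in_A[of 0] in_A[of "k - 1"] stable k by (metis diff_less stable_def zero_less_one)
    then show ?thesis using last first by linarith
  qed (use last first in linarith)
  \<comment> \<open>The span is at most \<open>2 * k + D - 2\<close>, of which the
    \<open>k - 1\<close> gaps need \<open>2 * (k - 1)\<close>.\<close>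
  have sl_le: "sl i \<le> D" if "i < k" for i
  proof -
    have "sl i \<le> sl (k - 1)" using that by (intro sl_mono) auto
    moreover have "xs ! (k - 1) = xs ! 0 + 2 * (k - 1) + sl (k - 1)" using k by (intro sl) simp
    ultimately show ?thesis using span k by linarith
  qed
  \<comment> \<open>By monotonicity this is the first index with excess above \<open>j\<close>, or
    \<open>k\<close> if there is none.\<close>
  define q where "q j = card {i. i < k \<and> sl i \<le> j}" for j
  have q_iff: "q j \<le> i \<longleftrightarrow> j < sl i" if "i < k" for i j
  proof
    assume *: "q j \<le> i"
    show "j < sl i"
    proof (rule ccontr)
      assume "\<not> j < sl i"
      then have "{..i} \<subseteq> {i. i < k \<and> sl i \<le> j}"
        using sl_mono[OF _ that] that by (fastforce intro: order_trans[of _ "sl i"])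
      then have "card {..i} \<le> q j" unfolding q_def by (intro card_mono) auto
      then show False using * by simp
    qed
  next
    assume "j < sl i"
    then have "{l. l < k \<and> sl l \<le> j} \<subseteq> {..<i}"
      using sl_mono[of i] by (fastforce simp: not_le[symmetric])
    then have "q j \<le> card {..<i}" unfolding q_def by (intro card_mono) auto
    then show "q j \<le> i" by simp
  qed
  have q_le: "q j \<le> k" for j
  proof -
    have "q j \<le> card {..<k}" unfolding q_def by (intro card_mono) auto
    then show ?thesis by simp
  qed
  define qs where "qs = map q [0..<D]"
  have spread: "spread (xs ! 0) qs i = xs ! i" if "i < k" for i
  proof -
    have "(\<Sum>q\<leftarrow>qs. 1 - (q - i)) = (\<Sum>j<D. 1 - (q j - i))"
      by (simp add: qs_def comp_def interv_sum_list_conv_sum_set_nat atLeast0LessThan)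
    also have "\<dots> = (\<Sum>j<D. if j < sl i then 1 else 0)"
    proof (rule sum.cong[OF refl])
      fix j
      show "1 - (q j - i) = (if j < sl i then 1 else 0 :: nat)"
        using q_iff[OF that, of j] by (cases "q j \<le> i") auto
    qed
    also have "\<dots> = card ({..<D} \<inter> {j. j < sl i})" by (simp add: sum.If_cases)
    also have "{..<D} \<inter> {j. j < sl i} = {..<sl i}" using sl_le[OF that] by auto
    finally show ?thesis using sl[OF that] by (simp add: spread_def)
  qed
  show ?thesis
  proof (rule that[of "xs ! 0" qs])
    show "A = spread_set (xs ! 0) qs k"
      using set len spread by (force simp: spread_set_def set_conv_nth image_iff)
    show "spread (xs ! 0) qs (k - 1) + 2 \<le> 2 * k + D + spread (xs ! 0) qs 0"
      using spread[of 0] spread[of "k - 1"] span k by simp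
  qed (use first q_le in \<open>auto simp: qs_def\<close>)
qed

text \<open>Membership in the vertex set appears as the inequalities of
  \<open>spread_set_vertex\<close>, which can be tested without a query.\<close>

definition good_pair :: "nat \<Rightarrow> nat \<Rightarrow> (nat set \<Rightarrow> 'a) \<Rightarrow> nat \<times> nat list \<Rightarrow> nat \<times> nat list \<Rightarrow> bool" where
  "good_pair n k col = (\<lambda>(a, qs) (b, rs).
     spread_set a qs k \<inter> spread_set b rs k = {} \<and> col (spread_set a qs k) = col (spread_set b rs k) \<and>
     1 \<le> a \<and> spread a qs (k - 1) \<le> n \<and> spread a qs (k - 1) + 2 \<le> n + spread a qs 0 \<and>
     1 \<le> b \<and> spread b rs (k - 1) \<le> n \<and> spread b rs (k - 1) + 2 \<le> n + spread b rs 0)"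

text \<open>Without such a pair every interval would need \<open>d\<close> colors, and no color
  could occur in two intervals; together this contradicts the bound on
  \<open>card M\<close>.\<close>

theorem good_pair_exists:
  fixes col :: "nat set \<Rightarrow> 'a"
  assumes d: "2 \<le> d" and k: "0 < k"
    and few: "finite M" "col ` schrijver_verts n k \<subseteq> M" "card M < d * (n div (2 * k + d - 2))"
  obtains a qs b rs where "good_pair n k col (a, qs) (b, rs)"
    "length qs = d - 2" "length rs = d - 2" "\<forall>q\<in>set qs. q \<le> k" "\<forall>q\<in>set rs. q \<le> k"
proof -
  define D where "D = d - 2"
  let ?N = "2 * k + D" and ?t = "n div (2 * k + d - 2)"
  have N: "2 * k + d - 2 = ?N" using d by (simp add: D_def)
  let ?V = "schrijver_verts ?N k"
  let ?sh = "\<lambda>b A. (\<lambda>x. x + b * ?N) ` A"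
  have bound: "?N + b * ?N \<le> n" if "b < ?t" for b
  proof -
    have "Suc b * ?N \<le> ?t * ?N" using that by (intro mult_right_mono) auto
    also have "\<dots> \<le> n" unfolding N by simp
    finally show ?thesis by simp
  qed
  have repr: "\<exists>a qs. ?sh b A = spread_set a qs k \<and> length qs = D \<and> (\<forall>q\<in>set qs. q \<le> k) \<and>
      1 \<le> a \<and> spread a qs (k - 1) \<le> n \<and> spread a qs (k - 1) + 2 \<le> n + spread a qs 0"
    if A: "A \<in> ?V" and b: "b < ?t" for A b
  proof -
    obtain a qs where *: "A = spread_set a qs k" "length qs = D" "\<forall>q\<in>set qs. q \<le> k" "1 \<le> a"
      "spread a qs (k - 1) + 2 \<le> ?N + spread a qs 0"
      by (rule schrijver_vert_spread[OF A k])
    have "spread a qs (k - 1) \<in> A" unfolding *(1) spread_set_def using k by auto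
    then have "spread a qs (k - 1) \<le> ?N" using A by (auto simp: schrijver_verts_def stable_def)
    then have "spread (a + b * ?N) qs (k - 1) \<le> n"
      using bound[OF b] by (simp add: spread_def)
    moreover have "spread (a + b * ?N) qs (k - 1) + 2 \<le> n + spread (a + b * ?N) qs 0"
      using *(5) bound[OF b] by (simp add: spread_def)
    ultimately show ?thesis
      using * spread_set_shift by (intro exI[of _ "a + b * ?N"] exI[of _ qs]) simp
  qed
  have vert: "?sh b A \<in> schrijver_verts n k" if "A \<in> ?V" "b < ?t" for A b
    using repr[OF that] spread_set_vertex[OF k] by metis
  have "\<exists>b<?t. \<exists>b'<?t. \<exists>A\<in>?V. \<exists>B\<in>?V. ?sh b A \<inter> ?sh b' B = {} \<and> col (?sh b A) = col (?sh b' B)"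
  proof (rule ccontr)
    assume none: "\<not> ?thesis"
    let ?C = "\<lambda>b. (\<lambda>A. col (?sh b A)) ` ?V"
    have card: "d \<le> card (?C b)" if "b < ?t" for b
    proof -
      have "?N + 2 \<le> 2 * k + card (?C b)"
      proof (rule schrijver_coloring_bound)
        fix A B assume AB: "A \<in> ?V" "B \<in> ?V" "A \<inter> B = {}"
        then have "?sh b A \<inter> ?sh b B = {}" by auto
        then show "col (?sh b A) \<noteq> col (?sh b B)" using none AB that by blast
      qed simp
      then show ?thesis using d by (simp add: D_def)
    qed
    have disj: "?C b \<inter> ?C b' = {}" if "b < ?t" "b' < ?t" "b \<noteq> b'" for b b'
    proof -
      have "col (?sh b A) \<noteq> col (?sh b' B)" if AB: "A \<in> ?V" "B \<in> ?V" for A B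
      proof -
        have "?sh b A \<inter> ?sh b' B = {}"
        proof (rule ccontr)
          assume "?sh b A \<inter> ?sh b' B \<noteq> {}"
          then obtain x y where xy: "x \<in> A" "y \<in> B" "x + b * ?N = y + b' * ?N" by auto
          have "x \<in> {1..?N}" "y \<in> {1..?N}" using AB xy by (auto simp: schrijver_verts_def stable_def)
          then have *: "x - 1 < ?N" "y - 1 < ?N" "(x - 1) + b * ?N = (y - 1) + b' * ?N"
            using xy(3) by auto
          \<comment> \<open>Elements start at 1, so \<open>x - 1\<close> is a remainder modulo
            \<open>?N\<close>, and the quotient recovers the index of the interval.\<close>
          have div: "(u + v * w) div w = v" if "u < w" for u v w :: nat using that by simp
          have "b = ((x - 1) + b * ?N) div ?N" using div[OF *(1)] by metis
          also have "\<dots> = b'" unfolding *(3) by (rule div[OF *(2)])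
          finally show False using \<open>b \<noteq> b'\<close> by simp
        qed
        then show ?thesis using none AB that \<open>b < ?t\<close> \<open>b' < ?t\<close> by blast
      qed
      then show ?thesis by blast
    qed
    have "d * ?t = (\<Sum>b<?t. d)" by simp
    also have "\<dots> \<le> (\<Sum>b<?t. card (?C b))" by (intro sum_mono card) simp
    also have "\<dots> = card (\<Union>b<?t. ?C b)"
      by (rule card_UN_disjoint[symmetric]) (use disj in auto)
    also have "\<dots> \<le> card M"
      using few vert by (intro card_mono) auto
    finally show False using few(3) by simp
  qed
  then obtain b b' A B where AB: "b < ?t" "b' < ?t" "A \<in> ?V" "B \<in> ?V"
    "?sh b A \<inter> ?sh b' B = {}" "col (?sh b A) = col (?sh b' B)" by blast
  obtain a qs where a: "?sh b A = spread_set a qs k" "length qs = D" "\<forall>q\<in>set qs. q \<le> k"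
      "1 \<le> a" "spread a qs (k - 1) \<le> n" "spread a qs (k - 1) + 2 \<le> n + spread a qs 0"
    using repr[OF AB(3,1)] by blast
  obtain a' rs where a': "?sh b' B = spread_set a' rs k" "length rs = D" "\<forall>q\<in>set rs. q \<le> k"
      "1 \<le> a'" "spread a' rs (k - 1) \<le> n" "spread a' rs (k - 1) + 2 \<le> n + spread a' rs 0"
    using repr[OF AB(4,2)] by blast
  have "good_pair n k col (a, qs) (a', rs)"
    using a a' AB(5,6) by (simp add: good_pair_def)
  then show ?thesis using that a a' by (simp add: D_def)
qed


section \<open>Weakest preconditions with a static step bound\<close>

text \<open>A bound on the number of steps if no loop has more than \<open>N\<close> iterations.\<close>

primrec cost :: "nat \<Rightarrow> program \<Rightarrow> nat" where
  "cost N (Move x a) = 1"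
| "cost N (Add x a b) = 1"
| "cost N (Sub x a b) = 1"
| "cost N (Load x a) = 1"
| "cost N (Store a b) = 1"
| "cost N (Query x a l) = 1"
| "cost N (Seq p q) = cost N p + cost N q"
| "cost N (Cond a p q) = Suc (cost N p + cost N q)"
| "cost N (Loop a p) = N * Suc (cost N p) + 1"

text \<open>The step bound is part of the predicate and depends only on \<open>p\<close> and
  \<open>N\<close>, so the correctness rules prove termination and running time along the
  way.\<close>

definition wp :: "coloring \<Rightarrow> nat \<Rightarrow> program \<Rightarrow> (state \<Rightarrow> bool) \<Rightarrow> state \<Rightarrow> bool" where
  "wp c N p Q s \<longleftrightarrow> (\<exists>t s'. exec c p s t s' \<and> t \<le> cost N p \<and> Q s')"

lemma wp_Move: "Q (r(x := opval a r), h) \<Longrightarrow> wp c N (Move x a) Q (r, h)"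
  unfolding wp_def by (rule exI[of _ 1]) (auto intro: exec.Move[unfolded One_nat_def])

lemma wp_Add: "Q (r(x := opval a r + opval b r), h) \<Longrightarrow> wp c N (Add x a b) Q (r, h)"
  unfolding wp_def by (rule exI[of _ 1]) (auto intro: exec.Add[unfolded One_nat_def])

lemma wp_Sub: "Q (r(x := opval a r - opval b r), h) \<Longrightarrow> wp c N (Sub x a b) Q (r, h)"
  unfolding wp_def by (rule exI[of _ 1]) (auto intro: exec.Sub[unfolded One_nat_def])

lemma wp_Load: "Q (r(x := h (opval a r)), h) \<Longrightarrow> wp c N (Load x a) Q (r, h)"
  unfolding wp_def by (rule exI[of _ 1]) (auto intro: exec.Load[unfolded One_nat_def])

lemma wp_Store: "Q (r, h(opval a r := opval b r)) \<Longrightarrow> wp c N (Store a b) Q (r, h)"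
  unfolding wp_def by (rule exI[of _ 1]) (auto intro: exec.Store[unfolded One_nat_def])

lemma wp_Query:
  "c (cells h (opval a r) (opval l r)) = Some v \<Longrightarrow> Q (r(x := v), h) \<Longrightarrow> wp c N (Query x a l) Q (r, h)"
  unfolding wp_def by (rule exI[of _ 1]) (auto intro: exec.Query[unfolded One_nat_def])

lemma wp_Seq: "wp c N p (wp c N q Q) s \<Longrightarrow> wp c N (Seq p q) Q s"
  unfolding wp_def by (fastforce intro: exec.Seq add_mono)

lemma wp_Cond:
  assumes "opval a r \<noteq> 0 \<Longrightarrow> wp c N p Q (r, h)" "opval a r = 0 \<Longrightarrow> wp c N q Q (r, h)"
  shows "wp c N (Cond a p q) Q (r, h)"
proof (cases "opval a r = 0")
  case True
  then obtain t s' where "exec c q (r, h) t s'" "t \<le> cost N q" "Q s'"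
    using assms(2) by (auto simp: wp_def)
  then show ?thesis
    unfolding wp_def by (intro exI[of _ "Suc t"] exI[of _ s']) (simp add: exec.CondFalse True)
next
  case False
  then obtain t s' where "exec c p (r, h) t s'" "t \<le> cost N p" "Q s'"
    using assms(1) by (auto simp: wp_def)
  then show ?thesis
    unfolding wp_def by (intro exI[of _ "Suc t"] exI[of _ s']) (simp add: exec.CondTrue False)
qed

lemmas wp_rules = wp_Move wp_Add wp_Sub wp_Load wp_Store wp_Seq wp_Cond

lemma wp_mono: "wp c N p Q s \<Longrightarrow> (\<And>s'. Q s' \<Longrightarrow> Q' s') \<Longrightarrow> wp c N p Q' s"
  unfolding wp_def by blast

section \<open>Blocks and counting loops\<close>

definition skip :: program where
  "skip = Move ''u'' (Reg ''u'')"

lemma wp_skip: "Q (r, h) \<Longrightarrow> wp c N skip Q (r, h)"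
  unfolding skip_def by (rule wp_Move) simp

lemma cost_skip [simp]: "cost N skip = 1"
  by (simp add: skip_def)

definition block :: "program list \<Rightarrow> program" where
  "block ps = foldr Seq ps skip"

lemma wp_block_Nil: "Q (r, h) \<Longrightarrow> wp c N (block []) Q (r, h)"
  by (simp add: block_def wp_skip)

lemma wp_block_Cons: "wp c N p (wp c N (block ps) Q) s \<Longrightarrow> wp c N (block (p # ps)) Q s"
  by (simp add: block_def wp_Seq)

lemma cost_block [simp]: "cost N (block ps) = (\<Sum>p\<leftarrow>ps. cost N p) + 1"
  by (induction ps) (simp_all add: block_def)

text \<open>Counting down suits the test for nonzero. The decrement comes before the body, which
  therefore sees the values from the bound minus 1 down to 0.\<close>

definition for_below :: "reg \<Rightarrow> operand \<Rightarrow> program \<Rightarrow> program" where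
  "for_below x b p = Seq (Move x b) (Loop (Reg x) (Seq (Sub x (Reg x) (Imm 1)) p))"

lemma cost_for_below [simp]: "cost N (for_below x b p) = N * (cost N p + 2) + 2"
  by (simp add: for_below_def)

text \<open>\<open>Inv v\<close> describes the state once all counter values from \<open>v\<close>
  on are done. The bound is read only at the start, and the body must leave the counter as it found
  it.\<close>

lemma wp_for_below:
  assumes le: "opval b r0 \<le> N"
    and init: "Inv (opval b r0) (r0(x := opval b r0), h0)"
    and step: "\<And>v r h. Inv (Suc v) (r, h) \<Longrightarrow> Suc v \<le> opval b r0 \<Longrightarrow>
      wp c N p (\<lambda>s'. fst s' x = v \<and> Inv v s') (r(x := v), h)"
    and final: "\<And>r h. Inv 0 (r, h) \<Longrightarrow> Q (r, h)"
  shows "wp c N (for_below x b p) Q (r0, h0)"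
proof -
  let ?body = "Seq (Sub x (Reg x) (Imm 1)) p"
  have loop: "\<exists>t s'. exec c (Loop (Reg x) ?body) (r, h) t s' \<and> t \<le> v * (cost N p + 2) + 1 \<and> Q s'"
    if "Inv v (r, h)" "r x = v" "v \<le> opval b r0" for v r h
    using that
  proof (induction v arbitrary: r h)
    case 0
    then show ?case using final exec.LoopFalse[of "Reg x" r c ?body h]
      by (intro exI[of _ 1] exI[of _ "(r, h)"]) simp
  next
    case (Suc v)
    obtain t r' h' where 1: "exec c p (r(x := v), h) t (r', h')" "t \<le> cost N p" "r' x = v" "Inv v (r', h')"
      using step[OF Suc.prems(1,3)] by (auto simp: wp_def)
    obtain t' s' where 2: "exec c (Loop (Reg x) ?body) (r', h') t' s'" "t' \<le> v * (cost N p + 2) + 1" "Q s'"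
      using Suc.IH[OF 1(4,3)] Suc.prems(3) by auto
    have "exec c (Sub x (Reg x) (Imm 1)) (r, h) 1 (r(x := v), h)"
      using exec.Sub[of c x "Reg x" "Imm 1" r h] Suc.prems(2) by simp
    then have "exec c ?body (r, h) (1 + t) (r', h')" using 1(1) by (rule exec.Seq)
    then have "exec c (Loop (Reg x) ?body) (r, h) (Suc ((1 + t) + t')) s'"
      using 2(1) Suc.prems(2) by (intro exec.LoopTrue) auto
    moreover have "Suc ((1 + t) + t') \<le> Suc v * (cost N p + 2) + 1" using 1(2) 2(2) by simp
    ultimately show ?case using 2(3) by blast
  qed
  obtain t s' where t: "exec c (Loop (Reg x) ?body) (r0(x := opval b r0), h0) t s'"
      "t \<le> opval b r0 * (cost N p + 2) + 1" "Q s'"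
    using loop[OF init] by auto
  have "exec c (for_below x b p) (r0, h0) (1 + t) s'"
    unfolding for_below_def by (rule exec.Seq[OF exec.Move t(1)])
  moreover have "1 + t \<le> cost N (for_below x b p)"
  proof -
    have "opval b r0 * (cost N p + 2) \<le> N * (cost N p + 2)" using le by (rule mult_right_mono) simp
    then show ?thesis using t(2) by simp
  qed
  ultimately show ?thesis using t(3) unfolding wp_def by blast
qed

section \<open>Writing a candidate set to memory\<close>

definition add_slack :: "reg list \<Rightarrow> program" where
  "add_slack qs = block (concat (map (\<lambda>q. [Sub ''u'' (Reg q) (Reg ''i''),
     Sub ''u'' (Imm 1) (Reg ''u''), Add ''v'' (Reg ''v'') (Reg ''u'')]) qs))"

text \<open>The two subtractions compute the summand \<open>1 - (q - i)\<close> of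
  \<open>spread\<close>. The sum is unrolled into straight-line code, one round for each register in
  \<open>qs\<close>.\<close>

lemma wp_add_slack:
  assumes "set qs \<inter> {''i'', ''u'', ''v''} = {}"
    and "\<And>r'. (\<And>y. y \<notin> {''u'', ''v''} \<Longrightarrow> r' y = r y) \<Longrightarrow>
      r' ''v'' = r ''v'' + (\<Sum>q\<leftarrow>map r qs. 1 - (q - r ''i'')) \<Longrightarrow> Q (r', h)"
  shows "wp c N (add_slack qs) Q (r, h)"
  using assms
proof (induction qs arbitrary: r)
  case Nil
  then show ?case by (auto simp: add_slack_def intro!: wp_block_Nil)
next
  case (Cons q qs)
  let ?d = "1 - (r q - r ''i'')"
  let ?r = "r(''u'' := ?d, ''v'' := r ''v'' + ?d)"
  have q: "q \<noteq> ''u''" "q \<noteq> ''v''" "q \<noteq> ''i''" using Cons.prems(1) by auto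
  have "wp c N (add_slack qs) Q (?r, h)"
  proof (rule Cons.IH)
    show "set qs \<inter> {''i'', ''u'', ''v''} = {}" using Cons.prems(1) by auto
    fix r' assume r': "\<And>y. y \<notin> {''u'', ''v''} \<Longrightarrow> r' y = ?r y"
      "r' ''v'' = ?r ''v'' + (\<Sum>q\<leftarrow>map ?r qs. 1 - (q - ?r ''i''))"
    have map: "map ?r qs = map r qs" by (rule map_cong[OF refl]) (use Cons.prems(1) in auto)
    show "Q (r', h)"
    proof (rule Cons.prems(2))
      show "r' y = r y" if "y \<notin> {''u'', ''v''}" for y using r'(1)[OF that] that by simp
      show "r' ''v'' = r ''v'' + (\<Sum>q\<leftarrow>map r (q # qs). 1 - (q - r ''i''))"
        using r'(2) unfolding map by simp
    qed
  qed
  moreover have "r(''u'' := r q - r ''i'', ''u'' := ?d, ''v'' := r ''v'' + ?d) = ?r" by simp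
  moreover have "add_slack (q # qs) = block (Sub ''u'' (Reg q) (Reg ''i'') #
      Sub ''u'' (Imm 1) (Reg ''u'') # Add ''v'' (Reg ''v'') (Reg ''u'') #
      concat (map (\<lambda>q. [Sub ''u'' (Reg q) (Reg ''i''), Sub ''u'' (Imm 1) (Reg ''u''),
        Add ''v'' (Reg ''v'') (Reg ''u'')]) qs))"
    by (simp add: add_slack_def)
  ultimately show ?case
    by (simp only:) (intro wp_block_Cons wp_Sub wp_Add, simp add: add_slack_def q)
qed

lemma cost_add_slack [simp]: "cost N (add_slack qs) = 3 * length qs + 1"
  by (induction qs) (simp_all add: add_slack_def)

definition write_spread :: "operand \<Rightarrow> reg \<Rightarrow> reg list \<Rightarrow> program" where
  "write_spread base x qs = for_below ''i'' (Reg ''k'') (block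
     [Add ''v'' (Reg x) (Imm 1), Add ''v'' (Reg ''v'') (Reg ''i''), Add ''v'' (Reg ''v'') (Reg ''i''),
      add_slack qs, Add ''u'' base (Reg ''i''), Store (Reg ''u'') (Reg ''v'')])"

lemma cost_write_spread [simp]: "cost N (write_spread base x qs) = N * (3 * length qs + 9) + 2"
  by (simp add: write_spread_def algebra_simps)

text \<open>The hypothesis on \<open>base\<close> covers both a constant address and an address in a
  register that the code does not touch. The successor of \<open>r x\<close> appears because loop
  counters start at 0 but elements at 1.\<close>

lemma wp_write_spread:
  assumes regs: "set (x # qs) \<inter> {''i'', ''u'', ''v'', ''k''} = {}"
    and base: "\<And>r'. (\<And>y. y \<notin> {''i'', ''u'', ''v''} \<Longrightarrow> r' y = r y) \<Longrightarrow> opval base r' = b"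
    and k: "r ''k'' \<le> N"
    and Q: "\<And>r' h'. (\<And>y. y \<notin> {''i'', ''u'', ''v''} \<Longrightarrow> r' y = r y) \<Longrightarrow>
      (\<And>j. j < r ''k'' \<Longrightarrow> h' (b + j) = spread (Suc (r x)) (map r qs) j) \<Longrightarrow>
      (\<And>a. a \<notin> {b..<b + r ''k''} \<Longrightarrow> h' a = h a) \<Longrightarrow> Q (r', h')"
  shows "wp c N (write_spread base x qs) Q (r, h)"
  unfolding write_spread_def
proof (rule wp_for_below[where Inv = "\<lambda>v (r', h'). (\<forall>y. y \<notin> {''i'', ''u'', ''v''} \<longrightarrow> r' y = r y) \<and>
     (\<forall>j<r ''k''. v \<le> j \<longrightarrow> h' (b + j) = spread (Suc (r x)) (map r qs) j) \<and>
     (\<forall>a. a \<notin> {b..<b + r ''k''} \<longrightarrow> h' a = h a)"], goal_cases)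
  case 1
  then show ?case using k by simp
next
  case 2
  then show ?case by simp
next
  case (3 v r1 h1)
  have r1: "r1 y = r y" if "y \<notin> {''i'', ''u'', ''v''}" for y using 3 that by auto
  have mem: "h1 (b + j) = spread (Suc (r x)) (map r qs) j" if "j < r ''k''" "Suc v \<le> j" for j
    using 3 that by auto
  have other: "h1 a = h a" if "a \<notin> {b..<b + r ''k''}" for a using 3 that by auto
  have v: "v < r ''k''" using 3 by simp
  let ?r2 = "r1(''i'' := v, ''v'' := Suc (r x) + v + v)"
  have x: "x \<noteq> ''i''" "x \<noteq> ''u''" "x \<noteq> ''v''" using regs by auto
  have "wp c N (add_slack qs) (wp c N (block [Add ''u'' base (Reg ''i''), Store (Reg ''u'') (Reg ''v'')])
      (\<lambda>s'. fst s' ''i'' = v \<and> (case s' of (r', h') \<Rightarrow> (\<forall>y. y \<notin> {''i'', ''u'', ''v''} \<longrightarrow> r' y = r y) \<and>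
     (\<forall>j<r ''k''. v \<le> j \<longrightarrow> h' (b + j) = spread (Suc (r x)) (map r qs) j) \<and>
     (\<forall>a. a \<notin> {b..<b + r ''k''} \<longrightarrow> h' a = h a)))) (?r2, h1)"
  proof (rule wp_add_slack)
    show "set qs \<inter> {''i'', ''u'', ''v''} = {}" using regs by auto
    fix r3 assume r3: "\<And>y. y \<notin> {''u'', ''v''} \<Longrightarrow> r3 y = ?r2 y"
      "r3 ''v'' = ?r2 ''v'' + (\<Sum>q\<leftarrow>map ?r2 qs. 1 - (q - ?r2 ''i''))"
    have map: "map ?r2 qs = map r qs"
    proof (rule map_cong[OF refl])
      fix q assume "q \<in> set qs"
      then have "q \<notin> {''i'', ''u'', ''v''}" using regs by auto
      then show "?r2 q = r q" using r1[of q] by simp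
    qed
    then have r3v: "r3 ''v'' = spread (Suc (r x)) (map r qs) v"
      using r3(2) unfolding map by (simp add: spread_def)
    have r3i: "r3 ''i'' = v" using r3(1)[of "''i''"] by simp
    have r3r: "r3 y = r y" if "y \<notin> {''i'', ''u'', ''v''}" for y using r3(1)[of y] r1[OF that] that by auto
    have base3: "opval base r3 = b" using r3r by (rule base)
    have "(h1(b + v := r3 ''v'')) (b + j) = spread (Suc (r x)) (map r qs) j" if "j < r ''k''" "v \<le> j" for j
      using mem[of j] that r3v by (cases "j = v") auto
    moreover have "(h1(b + v := r3 ''v'')) a = h a" if "a \<notin> {b..<b + r ''k''}" for a
      using other[OF that] v that by auto
    ultimately show "wp c N (block [Add ''u'' base (Reg ''i''), Store (Reg ''u'') (Reg ''v'')])
      (\<lambda>s'. fst s' ''i'' = v \<and> (case s' of (r', h') \<Rightarrow> (\<forall>y. y \<notin> {''i'', ''u'', ''v''} \<longrightarrow> r' y = r y) \<and>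
     (\<forall>j<r ''k''. v \<le> j \<longrightarrow> h' (b + j) = spread (Suc (r x)) (map r qs) j) \<and>
     (\<forall>a. a \<notin> {b..<b + r ''k''} \<longrightarrow> h' a = h a))) (r3, h1)"
      using r3i r3r by (intro wp_block_Cons wp_block_Nil wp_rules) (simp add: base3)
  qed
  moreover have "r1(''i'' := v, ''v'' := r1 x + 1, ''v'' := r1 x + 1 + v, ''v'' := r1 x + 1 + v + v) = ?r2"
    using r1[of x] x by simp
  ultimately show ?case
    by (intro wp_block_Cons[of _ _ "add_slack qs"] wp_block_Cons[of _ _ "Add _ _ _"] wp_Add) (simp add: x r1)
next
  case (4 r' h')
  then show ?case by (intro Q) auto
qed


section \<open>The search program\<close>

text \<open>The register \<open>g\<close> accumulates the violations found by the checks.\<close>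

definition check_span :: "operand \<Rightarrow> program" where
  "check_span base = block
     [Load ''u'' base, Add ''w'' base (Reg ''k''), Sub ''w'' (Reg ''w'') (Imm 1), Load ''w'' (Reg ''w''),
      Sub ''z'' (Reg ''w'') (Reg ''n''), Add ''g'' (Reg ''g'') (Reg ''z''),
      Add ''w'' (Reg ''w'') (Imm 2), Add ''u'' (Reg ''u'') (Reg ''n''),
      Sub ''w'' (Reg ''w'') (Reg ''u''), Add ''g'' (Reg ''g'') (Reg ''w'')]"

text \<open>A truncated difference is 0 exactly if the inequality holds, and a sum of naturals is 0
  exactly if all summands are.\<close>

lemma wp_check_span:
  assumes base: "\<And>r'. (\<And>y. y \<notin> {''u'', ''w'', ''z'', ''g''} \<Longrightarrow> r' y = r y) \<Longrightarrow> opval base r' = b"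
    and Q: "\<And>r'. (\<And>y. y \<notin> {''u'', ''w'', ''z'', ''g''} \<Longrightarrow> r' y = r y) \<Longrightarrow>
      (r' ''g'' = 0 \<longleftrightarrow> r ''g'' = 0 \<and> h (b + r ''k'' - 1) \<le> r ''n'' \<and>
         h (b + r ''k'' - 1) + 2 \<le> r ''n'' + h b) \<Longrightarrow> Q (r', h)"
  shows "wp c N (check_span base) Q (r, h)"
  unfolding check_span_def
proof (intro wp_block_Cons wp_block_Nil wp_rules, goal_cases)
  case 1
  have b1: "opval base r = b" by (rule base) simp
  have b2: "opval base (r(''u'' := a)) = b" for a by (rule base) simp
  show ?case by (rule Q) (auto simp: b1 b2)
qed

text \<open>The sum of the two truncated differences is the distance of the entries; 1 minus it is 1
  exactly if they coincide.\<close>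

definition check_disjoint :: program where
  "check_disjoint = for_below ''i'' (Reg ''k'') (for_below ''j'' (Reg ''k'') (block
     [Load ''u'' (Reg ''i''), Add ''v'' (Reg ''k'') (Reg ''j''), Load ''v'' (Reg ''v''),
      Sub ''w'' (Reg ''u'') (Reg ''v''), Sub ''z'' (Reg ''v'') (Reg ''u''),
      Add ''w'' (Reg ''w'') (Reg ''z''), Sub ''w'' (Imm 1) (Reg ''w''),
      Add ''g'' (Reg ''g'') (Reg ''w'')]))"

lemma all_at_least_split:
  "v < k \<Longrightarrow> (\<forall>i. v \<le> i \<and> i < k \<longrightarrow> P i) \<longleftrightarrow> (\<forall>i. Suc v \<le> i \<and> i < k \<longrightarrow> P i) \<and> P v" for k :: nat
  by (metis Suc_le_eq le_eq_less_or_eq)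

lemma wp_check_disjoint:
  assumes k: "r ''k'' \<le> N"
    and Q: "\<And>r'. (\<And>y. y \<notin> {''i'', ''j'', ''u'', ''v'', ''w'', ''z'', ''g''} \<Longrightarrow> r' y = r y) \<Longrightarrow>
      (r' ''g'' = 0 \<longleftrightarrow> r ''g'' = 0 \<and> (\<forall>i<r ''k''. \<forall>j<r ''k''. h i \<noteq> h (r ''k'' + j))) \<Longrightarrow> Q (r', h)"
  shows "wp c N check_disjoint Q (r, h)"
proof -
  define U where "U = {''i'', ''j'', ''u'', ''v'', ''w'', ''z'', ''g''}"
  let ?k = "r ''k''"
  let ?I = "\<lambda>v (r', h'). h' = h \<and> (\<forall>y. y \<notin> U \<longrightarrow> r' y = r y) \<and>
    (r' ''g'' = 0 \<longleftrightarrow> r ''g'' = 0 \<and> (\<forall>i. v \<le> i \<and> i < ?k \<longrightarrow> (\<forall>j<?k. h i \<noteq> h (?k + j))))"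
  show ?thesis
    unfolding check_disjoint_def
  proof (rule wp_for_below[where Inv = ?I], goal_cases)
    case 1
    then show ?case using k by simp
  next
    case 2
    then show ?case by (auto simp: U_def)
  next
    case (3 v r1 h1)
    have h1: "h1 = h" and r1: "\<And>y. y \<notin> U \<Longrightarrow> r1 y = r y" using 3 by auto
    have r1k: "r1 ''k'' = ?k" by (rule r1) (simp add: U_def)
    let ?J = "\<lambda>w (r', h'). h' = h \<and> (\<forall>y. y \<notin> U \<longrightarrow> r' y = r y) \<and> r' ''i'' = v \<and>
      (r' ''g'' = 0 \<longleftrightarrow> r1 ''g'' = 0 \<and> (\<forall>j. w \<le> j \<and> j < ?k \<longrightarrow> h v \<noteq> h (?k + j)))"
    show ?case
    proof (rule wp_for_below[where Inv = ?J], goal_cases)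
      case 1
      then show ?case using k r1k by simp
    next
      case 2
      then show ?case using h1 r1 by (auto simp: U_def)
    next
      case (3 w r2 h2)
      have h2: "h2 = h" and r2: "\<And>y. y \<notin> U \<Longrightarrow> r2 y = r y" and r2i: "r2 ''i'' = v"
        and r2g: "r2 ''g'' = 0 \<longleftrightarrow> r1 ''g'' = 0 \<and> (\<forall>j. Suc w \<le> j \<and> j < ?k \<longrightarrow> h v \<noteq> h (?k + j))"
        using 3(1) by auto
      have r2k: "r2 ''k'' = ?k" by (rule r2) (simp add: U_def)
      have w: "w < ?k" using 3(2) r1k by simp
      note all_at_least_split[OF w, of "\<lambda>j. h v \<noteq> h (?k + j)"]
      moreover have "1 - (a - b + (b - a)) = (0::nat) \<longleftrightarrow> a \<noteq> b" for a b :: nat by linarith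
      ultimately show ?case
        by (intro wp_block_Cons wp_block_Nil wp_rules) (simp add: r2k r2i r2g h2 r2 U_def)
    next
      case (4 r2 h2)
      have "v < ?k" using 3(2) by simp
      note all_at_least_split[OF this, of "\<lambda>i. \<forall>j<?k. h i \<noteq> h (?k + j)"]
      then show ?case using 3(1) 4 by simp
    qed
  next
    case (4 r' h')
    then have "h' = h" by simp
    moreover have "Q (r', h)" using 4 by (intro Q) (auto simp: U_def)
    ultimately show ?case by simp
  qed
qed

text \<open>The test of \<open>f\<close> keeps later iterations from overwriting an edge already
  found; the test of \<open>g\<close> guards the queries, which get stuck on a non-vertex.\<close>

definition try_pair :: "reg \<Rightarrow> reg list \<Rightarrow> reg \<Rightarrow> reg list \<Rightarrow> program" where
  "try_pair x qs y ss = Cond (Reg ''f'') skip (block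
     [Move ''g'' (Imm 0), write_spread (Imm 0) x qs, write_spread (Reg ''k'') y ss,
      check_span (Imm 0), check_span (Reg ''k''), check_disjoint,
      Cond (Reg ''g'') skip (block
        [Query ''u'' (Imm 0) (Reg ''k''), Query ''v'' (Reg ''k'') (Reg ''k''),
         Sub ''w'' (Reg ''u'') (Reg ''v''), Sub ''z'' (Reg ''v'') (Reg ''u''),
         Add ''w'' (Reg ''w'') (Reg ''z''), Cond (Reg ''w'') skip (Move ''f'' (Imm 1))])])"

definition loop_nest :: "reg list \<Rightarrow> program \<Rightarrow> program" where
  "loop_nest = foldr (\<lambda>x. for_below x (Reg ''n''))"

lemma cells_eq_spread_set:
  assumes "\<And>j. j < k \<Longrightarrow> h (b + j) = spread a qs j"
  shows "cells h b k = spread_set a qs k"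
proof -
  have "{b..<b + k} = (+) b ` {..<k}" by (simp add: lessThan_atLeast0 add.commute)
  then show ?thesis using assms by (simp add: cells_def spread_set_def image_image)
qed

section \<open>Correctness of the search\<close>

locale schrijver_search =
  fixes n k :: nat and c :: coloring
  assumes k_pos: "0 < k" and k_le: "2 * k \<le> n" and dom_c: "dom c = schrijver_verts n k"
begin

text \<open>The register \<open>f\<close> says that the memory holds a monochromatic edge.\<close>

definition search_inv :: "state \<Rightarrow> bool" where
  "search_inv = (\<lambda>(r, h). r ''n'' = n \<and> r ''k'' = k \<and> r ''A'' = 0 \<and> r ''B'' = k \<and>
     (r ''f'' \<noteq> 0 \<longrightarrow> monochromatic_edge n k c (cells h 0 k) (cells h k k)))"

definition reserved :: "reg set" where
  "reserved = {''n'', ''k'', ''A'', ''B'', ''f'', ''g'', ''i'', ''j'', ''u'', ''v'', ''w'', ''z''}"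

text \<open>If \<open>g\<close> is nonzero after the checks, \<open>good_pair\<close> fails. If it
  is 0, both candidates are vertices, the queries return, and equality of the colors decides.
  \<open>Y\<close> stands for all loop registers of the nest.\<close>

lemma wp_try_pair:
  assumes inv: "search_inv (r, h)" and regs: "set (x # qs @ y # ss) \<subseteq> Y" "Y \<inter> reserved = {}"
  shows "wp c n (try_pair x qs y ss) (\<lambda>(r', h'). search_inv (r', h') \<and> (\<forall>y\<in>Y. r' y = r y) \<and>
    (r ''f'' \<noteq> 0 \<or> good_pair n k c (Suc (r x), map r qs) (Suc (r y), map r ss) \<longrightarrow> r' ''f'' \<noteq> 0)) (r, h)"
    (is "wp c n _ ?Q _")
proof -
  define U where "U = {''g'', ''i'', ''j'', ''u'', ''v'', ''w'', ''z''}"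
  have rn: "r ''n'' = n" "r ''k'' = k" "r ''A'' = 0" "r ''B'' = k" using inv by (auto simp: search_inv_def)
  have notU: "z \<notin> U" if "z \<in> {''n'', ''k'', ''A'', ''B'', ''f''} \<union> Y" for z
    using that regs(2) by (auto simp: U_def reserved_def)
  let ?A = "spread (Suc (r x)) (map r qs)" and ?B = "spread (Suc (r y)) (map r ss)"
  let ?SA = "spread_set (Suc (r x)) (map r qs) k" and ?SB = "spread_set (Suc (r y)) (map r ss) k"
  let ?span = "\<lambda>f. f (k - 1) \<le> n \<and> f (k - 1) + 2 \<le> n + f 0"
  let ?query = "Cond (Reg ''g'') skip (block
        [Query ''u'' (Imm 0) (Reg ''k''), Query ''v'' (Reg ''k'') (Reg ''k''),
         Sub ''w'' (Reg ''u'') (Reg ''v''), Sub ''z'' (Reg ''v'') (Reg ''u''),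
         Add ''w'' (Reg ''w'') (Reg ''z''), Cond (Reg ''w'') skip (Move ''f'' (Imm 1))])"
  show ?thesis
    unfolding try_pair_def
  proof (intro wp_Cond wp_skip)
    assume "opval (Reg ''f'') r \<noteq> 0"
    then show "?Q (r, h)" using inv by simp
  next
    assume f: "opval (Reg ''f'') r = 0"
    \<comment> \<open>The block is verified from its end: first the queries, for any state in which
      \<open>g\<close> carries the outcome of the checks, then the checks, then the writing.\<close>
    have query: "wp c n (block [?query]) ?Q (r', h')"
      if r': "\<And>z. z \<notin> U \<Longrightarrow> r' z = r z"
        and g: "r' ''g'' = 0 \<longleftrightarrow> ?span ?A \<and> ?span ?B \<and> ?SA \<inter> ?SB = {}"
        and cells: "cells h' 0 k = ?SA" "cells h' k k = ?SB" for r' h'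
    proof -
      have regs': "r' ''n'' = n" "r' ''k'' = k" "r' ''A'' = 0" "r' ''B'' = k" "r' ''f'' = 0"
        using r' notU rn f by simp_all
      have Y: "\<forall>z\<in>Y. r' z = r z" using r' notU by blast
      have work: "''u'' \<notin> Y" "''v'' \<notin> Y" "''w'' \<notin> Y" "''z'' \<notin> Y" "''f'' \<notin> Y"
        using regs(2) by (auto simp: reserved_def)
      show ?thesis
      proof (rule wp_block_Cons, rule wp_Cond, rule wp_skip)
        assume "opval (Reg ''g'') r' \<noteq> 0"
        then have "\<not> good_pair n k c (Suc (r x), map r qs) (Suc (r y), map r ss)"
          using g by (auto simp: good_pair_def)
        then show "wp c n (block []) ?Q (r', h')"
          using regs' Y f by (intro wp_block_Nil) (simp add: search_inv_def)
      next
        assume "opval (Reg ''g'') r' = 0"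
        then have ok: "?span ?A" "?span ?B" "?SA \<inter> ?SB = {}" using g by auto
        have V: "?SA \<in> schrijver_verts n k" "?SB \<in> schrijver_verts n k"
          using ok k_pos by (auto intro!: spread_set_vertex)
        then obtain a b where ab: "c ?SA = Some a" "c ?SB = Some b"
          unfolding dom_c[symmetric] by blast
        have good: "good_pair n k c (Suc (r x), map r qs) (Suc (r y), map r ss) \<longleftrightarrow> a = b"
          using ok ab by (simp add: good_pair_def)
        have edge: "monochromatic_edge n k c ?SA ?SB \<longleftrightarrow> a = b"
          using V ok(3) ab by (simp add: monochromatic_edge_def schrijver_adj_def)
        have diff: "a - b + (b - a) = 0 \<longleftrightarrow> a = b" by linarith
        show "wp c n (block [Query ''u'' (Imm 0) (Reg ''k''), Query ''v'' (Reg ''k'') (Reg ''k''),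
         Sub ''w'' (Reg ''u'') (Reg ''v''), Sub ''z'' (Reg ''v'') (Reg ''u''),
         Add ''w'' (Reg ''w'') (Reg ''z''), Cond (Reg ''w'') skip (Move ''f'' (Imm 1))])
         (wp c n (block []) ?Q) (r', h')"
        proof (rule wp_block_Cons, rule wp_Query[of _ _ _ _ _ a], goal_cases)
          case 1
          show ?case using cells ab regs' by simp
        next
          case 2
          show ?case
          proof (rule wp_block_Cons, rule wp_Query[of _ _ _ _ _ b], goal_cases)
            case 1
            show ?case using cells ab regs' by simp
          next
            case 2
            show ?case
              using regs' good edge diff cells f Y
              by (intro wp_block_Cons wp_block_Nil wp_rules wp_skip)
                (auto simp: search_inv_def work)
          qed
        qed
      qed
    qed
    have checks: "wp c n (block [check_span (Imm 0), check_span (Reg ''k''), check_disjoint, ?query]) ?Q (r', h')"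
      if r': "\<And>z. z \<notin> U \<Longrightarrow> r' z = r z" and g: "r' ''g'' = 0"
        and hA: "\<And>j. j < k \<Longrightarrow> h' j = ?A j" and hB: "\<And>j. j < k \<Longrightarrow> h' (k + j) = ?B j" for r' h'
    proof -
      have regs': "r' ''n'' = n" "r' ''k'' = k" using r' notU rn by simp_all
      have cells: "cells h' 0 k = ?SA" "cells h' k k = ?SB"
        using hA hB by (auto intro!: cells_eq_spread_set)
      have disj: "?SA \<inter> ?SB = {} \<longleftrightarrow> (\<forall>i<k. \<forall>j<k. h' i \<noteq> h' (k + j))"
        using hA hB by (auto simp: spread_set_def)
      have ends: "h' 0 = ?A 0" "h' (k - 1) = ?A (k - 1)" "h' k = ?B 0" "h' (k + k - 1) = ?B (k - 1)"
        using hA[of 0] hA[of "k - 1"] hB[of 0] hB[of "k - 1"] k_pos by simp_all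
      show ?thesis
      proof (rule wp_block_Cons, rule wp_check_span[where b = 0], goal_cases)
        case (1 r2)
        show ?case by simp
      next
        case (2 r2)
        note r2 = 2
        show ?case
        proof (rule wp_block_Cons, rule wp_check_span[where b = k], goal_cases)
          case (1 r3)
          then show ?case using r2(1)[of "''k''"] regs' by simp
        next
          case (2 r3)
          note r3 = 2
          have regs3: "r3 ''k'' = k" "r2 ''k'' = k" "r2 ''n'' = n"
            using r3(1) r2(1) regs' by simp_all
          show ?case
          proof (rule wp_block_Cons, rule wp_check_disjoint, goal_cases)
            case 1
            show ?case using regs3 k_le by simp
          next
            case (2 r4)
            show ?case
            proof (rule query)
              show "r4 z = r z" if "z \<notin> U" for z
                using 2(1)[of z] r3(1)[of z] r2(1)[of z] r'[of z] that by (simp add: U_def)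
              show "r4 ''g'' = 0 \<longleftrightarrow> ?span ?A \<and> ?span ?B \<and> ?SA \<inter> ?SB = {}"
                unfolding 2(2) r3(2) r2(2) disj using regs3 regs' g ends by simp
            qed (rule cells)+
          qed
        qed
      qed
    qed
    show "wp c n (block [Move ''g'' (Imm 0), write_spread (Imm 0) x qs, write_spread (Reg ''k'') y ss,
      check_span (Imm 0), check_span (Reg ''k''), check_disjoint, ?query]) ?Q (r, h)"
    proof (rule wp_block_Cons, rule wp_Move, rule wp_block_Cons, rule wp_write_spread[where b = 0], goal_cases)
      case 1
      show ?case using regs by (auto simp: reserved_def)
    next
      case (2 r')
      show ?case by simp
    next
      case 3
      show ?case using rn k_le by simp
    next
      case (4 r1 h1)
      note r1 = 4
      have r1': "r1 z = r z" if "z \<notin> U" for z using r1(1)[of z] that by (simp add: U_def)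
      have upd: "(r(''g'' := opval (Imm 0) r)) z = r z" if "z \<in> set (x # qs)" for z
        using that regs by (auto simp: reserved_def)
      have h1: "h1 j = ?A j" if "j < k" for j
      proof -
        have map: "map (r(''g'' := opval (Imm 0) r)) qs = map r qs"
          by (rule map_cong[OF refl]) (rule upd, simp)
        have x: "(r(''g'' := opval (Imm 0) r)) x = r x" by (rule upd) simp
        show ?thesis using r1(2)[of j] that rn unfolding map x by simp
      qed
      show ?case
      proof (rule wp_block_Cons, rule wp_write_spread[where b = k], goal_cases)
        case 1
        show ?case using regs by (auto simp: reserved_def)
      next
        case (2 r')
        show ?case using 2[of "''k''"] r1'[of "''k''"] rn by (simp add: U_def)
      next
        case 3
        show ?case using r1'[of "''k''"] rn k_le by (simp add: U_def)
      next
        case (4 r2 h2)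
        have r1k: "r1 ''k'' = k" using r1'[of "''k''"] rn by (simp add: U_def)
        show ?case
        proof (rule checks)
          show "r2 z = r z" if "z \<notin> U" for z using 4(1)[of z] r1'[OF that] that by (simp add: U_def)
          show "r2 ''g'' = 0" using 4(1)[of "''g''"] r1(1)[of "''g''"] by simp
          show "h2 j = ?A j" if "j < k" for j using 4(3)[of j] h1[OF that] that r1k by simp
          have eq: "r1 z = r z" if "z \<in> set (y # ss)" for z
            using that regs notU by (intro r1') auto
          have map: "map r1 ss = map r ss" by (rule map_cong[OF refl]) (rule eq, simp)
          have y: "r1 y = r y" by (rule eq) simp
          show "h2 (k + j) = ?B j" if "j < k" for j
            using 4(2)[of j] r1k that unfolding map y by simp
        qed
      qed
    qed
  qed
qed

text \<open>Fixing the successful valuation \<open>\<rho>\<close> of the loop variables in advance turns the search of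
  nested loops into a statement about the one iteration that agrees with \<open>\<rho>\<close>.\<close>

definition searches :: "(reg \<Rightarrow> nat) \<Rightarrow> program \<Rightarrow> reg set \<Rightarrow> bool" where
  "searches \<rho> p Y \<longleftrightarrow> (\<forall>r h. search_inv (r, h) \<longrightarrow> wp c n p (\<lambda>(r', h'). search_inv (r', h') \<and>
     (\<forall>y\<in>Y. r' y = r y) \<and> (r ''f'' \<noteq> 0 \<or> (\<forall>y\<in>Y. r y = \<rho> y) \<longrightarrow> r' ''f'' \<noteq> 0)) (r, h))"

text \<open>The invariant requires success only once the descending counter has reached
  \<open>\<rho> x\<close>. That iteration gets it from \<open>p\<close>, and the later ones preserve
  it; \<open>\<rho> x < n\<close> ensures that it takes place.\<close>

lemma searches_for_below:
  assumes p: "searches \<rho> p (insert x Y)" and x: "x \<notin> Y" "x \<notin> reserved" "\<rho> x < n"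
  shows "searches \<rho> (for_below x (Reg ''n'') p) Y"
  unfolding searches_def
proof (intro allI impI)
  fix r h assume inv: "search_inv (r, h)"
  then have rn: "r ''n'' = n" by (simp add: search_inv_def)
  have inv_upd: "search_inv (r'(x := a), h')" if "search_inv (r', h')" for r' h' a
    using that x(2) by (auto simp: search_inv_def reserved_def)
  let ?I = "\<lambda>v (r', h'). search_inv (r', h') \<and> (\<forall>y\<in>Y. r' y = r y) \<and>
     (r ''f'' \<noteq> 0 \<or> (\<forall>y\<in>Y. r y = \<rho> y) \<and> v \<le> \<rho> x \<longrightarrow> r' ''f'' \<noteq> 0)"
  have xf: "x \<noteq> ''f''" using x(2) by (auto simp: reserved_def)
  show "wp c n (for_below x (Reg ''n'') p) (\<lambda>(r', h'). search_inv (r', h') \<and>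
     (\<forall>y\<in>Y. r' y = r y) \<and> (r ''f'' \<noteq> 0 \<or> (\<forall>y\<in>Y. r y = \<rho> y) \<longrightarrow> r' ''f'' \<noteq> 0)) (r, h)"
  proof (rule wp_for_below[where Inv = ?I], goal_cases)
    case 1
    show ?case using rn by simp
  next
    case 2
    show ?case using rn inv_upd[OF inv] x xf by auto
  next
    case (3 v r1 h1)
    then have r1: "search_inv (r1, h1)" "\<forall>y\<in>Y. r1 y = r y"
      "r ''f'' \<noteq> 0 \<or> (\<forall>y\<in>Y. r y = \<rho> y) \<and> Suc v \<le> \<rho> x \<longrightarrow> r1 ''f'' \<noteq> 0" by auto
    have "wp c n p (\<lambda>(r', h'). search_inv (r', h') \<and> (\<forall>y\<in>insert x Y. r' y = (r1(x := v)) y) \<and>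
       ((r1(x := v)) ''f'' \<noteq> 0 \<or> (\<forall>y\<in>insert x Y. (r1(x := v)) y = \<rho> y) \<longrightarrow> r' ''f'' \<noteq> 0)) (r1(x := v), h1)"
      using p inv_upd[OF r1(1)] unfolding searches_def by blast
    then show ?case
    proof (rule wp_mono)
      fix s' :: state
      assume *: "case s' of (r', h') \<Rightarrow> search_inv (r', h') \<and> (\<forall>y\<in>insert x Y. r' y = (r1(x := v)) y) \<and>
       ((r1(x := v)) ''f'' \<noteq> 0 \<or> (\<forall>y\<in>insert x Y. (r1(x := v)) y = \<rho> y) \<longrightarrow> r' ''f'' \<noteq> 0)"
      obtain r' h' where s': "s' = (r', h')" by (cases s')
      have Y: "(r1(x := v)) y = r y" if "y \<in> Y" for y using that x(1) r1(2) by auto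
      have "r' ''f'' \<noteq> 0" if "r ''f'' \<noteq> 0 \<or> (\<forall>y\<in>Y. r y = \<rho> y) \<and> v \<le> \<rho> x"
      proof (cases "r1 ''f'' \<noteq> 0")
        case True
        then show ?thesis using * s' xf by simp
      next
        case False
        then have "\<forall>y\<in>Y. r y = \<rho> y" "v = \<rho> x" using r1(3) that by auto
        then have "\<forall>y\<in>insert x Y. (r1(x := v)) y = \<rho> y" using Y by auto
        then show ?thesis using * s' by auto
      qed
      then show "fst s' x = v \<and> ?I v s'" using * s' Y by simp
    qed
  next
    case (4 r' h')
    then show ?case by simp
  qed
qed

text \<open>\<open>Y\<close> holds the registers of the enclosing loops. For the whole nest it is
  empty, so agreement with \<open>\<rho>\<close> is vacuous and success unconditional.\<close>

lemma searches_loop_nest: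
  assumes "searches \<rho> p (set xs \<union> Y)" "distinct xs" "set xs \<inter> Y = {}" "set xs \<inter> reserved = {}"
    "\<forall>x\<in>set xs. \<rho> x < n"
  shows "searches \<rho> (loop_nest xs p) Y"
  using assms
proof (induction xs arbitrary: Y)
  case Nil
  then show ?case by (simp add: loop_nest_def)
next
  case (Cons x xs)
  have "searches \<rho> (loop_nest xs p) (insert x Y)"
    using Cons.prems by (intro Cons.IH) auto
  then show ?case
    unfolding loop_nest_def by (auto intro!: searches_for_below simp: Cons.prems) (use Cons.prems in auto)
qed

lemma searches_try_pair:
  assumes "set (x # qs @ y # ss) \<inter> reserved = {}"
    and good: "good_pair n k c (Suc (\<rho> x), map \<rho> qs) (Suc (\<rho> y), map \<rho> ss)"
  shows "searches \<rho> (try_pair x qs y ss) (set (x # qs @ y # ss))"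
  unfolding searches_def
proof (intro allI impI)
  fix r h assume inv: "search_inv (r, h)"
  let ?Y = "set (x # qs @ y # ss)"
  have g: "good_pair n k c (Suc (r x), map r qs) (Suc (r y), map r ss)" if "\<forall>y\<in>?Y. r y = \<rho> y"
  proof -
    have "map r qs = map \<rho> qs" "map r ss = map \<rho> ss" "r x = \<rho> x" "r y = \<rho> y"
      using that by auto
    then show ?thesis using good by (simp only:)
  qed
  show "wp c n (try_pair x qs y ss) (\<lambda>(r', h'). search_inv (r', h') \<and>
     (\<forall>y\<in>?Y. r' y = r y) \<and> (r ''f'' \<noteq> 0 \<or> (\<forall>y\<in>?Y. r y = \<rho> y) \<longrightarrow> r' ''f'' \<noteq> 0)) (r, h)"
    by (rule wp_mono[OF wp_try_pair[OF inv order_refl assms(1)]]) (use g in auto)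
qed

end

section \<open>The complete program and its running time\<close>

definition xreg :: "nat \<Rightarrow> reg" where
  "xreg j = replicate (Suc j) (CHR ''x'')"

text \<open>\<open>xreg 0\<close> and \<open>xreg (d - 1)\<close> hold the minima less 1, and the
  \<open>d - 2\<close> registers after each hold the gap positions of that set. The first set is at
  address 0, the initial value of register \<open>A\<close>; the second one is at address
  \<open>k\<close>.\<close>

definition search_program :: "nat \<Rightarrow> program" where
  "search_program d = Seq (Move ''B'' (Reg ''k'')) (loop_nest (map xreg [0..<2 * (d - 1)])
     (try_pair (xreg 0) (map xreg [1..<d - 1]) (xreg (d - 1)) (map xreg [d..<2 * (d - 1)])))"

lemma inj_xreg: "inj xreg"
  by (rule injI) (metis length_replicate nat.inject xreg_def)

lemma (in schrijver_search) xreg_not_reserved: "xreg j \<notin> reserved"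
proof
  assume "xreg j \<in> reserved"
  moreover have "CHR ''x'' \<in> set (xreg j)" by (simp add: xreg_def)
  moreover have "\<forall>y\<in>reserved. CHR ''x'' \<notin> set y" by (simp add: reserved_def)
  ultimately show False by blast
qed

text \<open>A loop multiplies the cost by \<open>n\<close> and adds \<open>2 * n + 2\<close>; for
  \<open>2 \<le> n\<close> a factor \<open>n ^ 2\<close> covers both, hence the 2 per loop in the
  exponent.\<close>

lemma cost_loop_nest:
  assumes "cost n p \<le> n ^ a" "2 \<le> a" "2 \<le> n"
  shows "cost n (loop_nest xs p) \<le> n ^ (2 * length xs + a)"
proof (induction xs)
  case Nil
  then show ?case using assms(1) by (simp add: loop_nest_def)
next
  case (Cons x xs)
  let ?e = "2 * length xs + a"
  have "cost n (loop_nest (x # xs) p) = n * (cost n (loop_nest xs p) + 2) + 2"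
    by (simp add: loop_nest_def)
  also have "\<dots> \<le> n * (n ^ ?e + 2) + 2" using Cons.IH by simp
  also have "\<dots> \<le> n ^ ?e * n + n ^ ?e * n"
  proof -
    have "n ^ 2 \<le> n ^ ?e" using assms by (intro power_increasing) auto
    moreover have "2 * n \<le> n ^ 2" using assms(3) by (simp add: power2_eq_square)
    ultimately have "2 * n * n \<le> n ^ ?e * n" by (intro mult_right_mono) auto
    moreover have "2 * n + 2 \<le> 2 * n * n"
    proof -
      have "2 * n * 2 \<le> 2 * n * n" using assms(3) by (intro mult_left_mono) auto
      then show ?thesis using assms(3) by linarith
    qed
    ultimately have "2 * n + 2 \<le> n ^ ?e * n" by linarith
    then show ?thesis unfolding distrib_left mult.commute[of n "n ^ ?e"] by linarith
  qed
  also have "\<dots> = n ^ ?e * n * 2" by simp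
  also have "\<dots> \<le> n ^ ?e * n * n" using assms(3) by (intro mult_left_mono) auto
  also have "\<dots> = n ^ (2 * length (x # xs) + a)" by simp
  finally show ?case .
qed

text \<open>The cost is quadratic in \<open>n\<close> once \<open>length qs\<close> and
  \<open>length ss\<close> are bounded by \<open>n\<close>. The constant 64 is absorbed as
  \<open>2 ^ 6 \<le> n ^ 6\<close>.\<close>

lemma cost_try_pair:
  assumes "length qs + 2 \<le> n" "length ss + 2 \<le> n"
  shows "cost n (try_pair x qs y ss) \<le> n ^ 8"
proof -
  have "cost n (try_pair x qs y ss) =
      n * (3 * length qs + 9) + n * (3 * length ss + 9) + n * (n * 11 + 4) + 43"
    by (simp add: try_pair_def check_span_def check_disjoint_def algebra_simps)
  also have "\<dots> \<le> n * (3 * n + 3) + n * (3 * n + 3) + n * (n * 11 + 4) + 43"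
  proof -
    have "n * (3 * l + 9) \<le> n * (3 * n + 3)" if "l + 2 \<le> n" for l
      using that by (intro mult_left_mono) auto
    from this[OF assms(1)] this[OF assms(2)] show ?thesis by linarith
  qed
  also have "\<dots> = 17 * (n * n) + 10 * n + 43" by (simp add: algebra_simps)
  also have "\<dots> \<le> 64 * (n * n)"
  proof -
    have n: "2 \<le> n" using assms by simp
    then have "2 * n \<le> n * n" by simp
    then show ?thesis using n by linarith
  qed
  also have "\<dots> \<le> n ^ 6 * (n * n)"
  proof (rule mult_right_mono)
    have "2 ^ 6 \<le> n ^ 6" using assms by (intro power_mono) auto
    then show "64 \<le> n ^ 6" by simp
  qed simp
  also have "\<dots> = n ^ 8" by (simp add: eval_nat_numeral)
  finally show ?thesis .
qed

lemma search_program_finds_edge: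
  assumes d: "2 \<le> d" and inst: "schrijver_instance m n k c"
    and few: "m n k < d * (n div (2 * k + d - 2))"
  shows "finds_monochromatic_edge (search_program d) n k c (n ^ (4 * d + 5))"
proof -
  have k: "0 < k" "2 * k \<le> n" and dom: "dom c = schrijver_verts n k" and ran: "ran c \<subseteq> {1..m n k}"
    using inst by (auto simp: schrijver_instance_def)
  interpret schrijver_search n k c by unfold_locales (use k dom in auto)
  \<comment> \<open>With quotient 0 the hypothesis \<open>few\<close> would be false. So one
    interval fits, which gives \<open>d \<le> n\<close>.\<close>
  have "0 < n div (2 * k + d - 2)" using few by (cases "n div (2 * k + d - 2)") auto
  then have "2 * k + d - 2 \<le> n" by (simp add: div_greater_zero_iff)
  then have dn: "d \<le> n" using k by linarith
  \<comment> \<open>The partial function \<open>c\<close> itself serves as the coloring, with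
    options as colors.\<close>
  have "c ` schrijver_verts n k \<subseteq> Some ` {1..m n k}"
    using ran unfolding dom[symmetric] by (force simp: ran_def dom_def)
  moreover have "card (Some ` {1..m n k}) < d * (n div (2 * k + d - 2))"
    using few by (simp add: card_image)
  ultimately obtain a qs b rs where good: "good_pair n k c (a, qs) (b, rs)"
      and len: "length qs = d - 2" "length rs = d - 2"
      and le: "\<forall>q\<in>set qs. q \<le> k" "\<forall>q\<in>set rs. q \<le> k"
    using good_pair_exists[OF d k(1), of "Some ` {1..m n k}" c n] by blast
  have ab: "1 \<le> a" "1 \<le> b" "a \<le> n" "b \<le> n"
    using good by (auto simp: good_pair_def spread_def)
  \<comment> \<open>The successful values in the order of the loop registers;
    \<open>length y - 1\<close> recovers the index from the unary name of a register.\<close>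
  define vals where "vals = (a - 1) # qs @ (b - 1) # rs"
  define \<rho> where "\<rho> y = vals ! (length y - 1)" for y :: reg
  have \<rho>: "\<rho> (xreg j) = vals ! j" for j by (simp add: \<rho>_def xreg_def)
  have lvals: "length vals = 2 * (d - 1)" using d len by (simp add: vals_def)
  let ?x = "xreg 0" and ?qs = "map xreg [1..<d - 1]" and ?y = "xreg (d - 1)"
    and ?ss = "map xreg [d..<2 * (d - 1)]" and ?xs = "map xreg [0..<2 * (d - 1)]"
  have xs: "?xs = ?x # ?qs @ ?y # ?ss"
  proof -
    have "[0..<2 * (d - 1)] = 0 # [1..<d - 1] @ (d - 1) # [d..<2 * (d - 1)]"
    proof -
      have "[0..<2 * (d - 1)] = [0..<d - 1] @ [d - 1..<2 * (d - 1)]"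
        by (metis le_add2 mult_2 upt_add_eq_append zero_le)
      moreover have "[0..<d - 1] = 0 # [1..<d - 1]" using d by (simp add: upt_conv_Cons)
      moreover have "[d - 1..<2 * (d - 1)] = (d - 1) # [d..<2 * (d - 1)]"
        using d by (simp add: upt_conv_Cons)
      ultimately show ?thesis by simp
    qed
    then show ?thesis by simp
  qed
  have qs: "map \<rho> ?qs = qs"
    using len by (intro nth_equalityI) (auto simp: \<rho> vals_def nth_append)
  have ss: "map \<rho> ?ss = rs"
    using len d by (intro nth_equalityI) (auto simp: \<rho> vals_def nth_append)
  have xy: "Suc (\<rho> ?x) = a" "Suc (\<rho> ?y) = b"
    using ab len d by (auto simp: \<rho> vals_def nth_append)
  have res: "set ?xs \<inter> reserved = {}" using xreg_not_reserved by auto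
  have "searches \<rho> (try_pair ?x ?qs ?y ?ss) (set ?xs \<union> {})"
    unfolding xs Un_empty_right
  proof (rule searches_try_pair)
    show "set (?x # ?qs @ ?y # ?ss) \<inter> reserved = {}" using res unfolding xs .
    show "good_pair n k c (Suc (\<rho> ?x), map \<rho> ?qs) (Suc (\<rho> ?y), map \<rho> ?ss)"
      using good unfolding qs ss xy .
  qed
  moreover have "\<forall>x\<in>set ?xs. \<rho> x < n"
  proof
    fix x assume "x \<in> set ?xs"
    then obtain j where "x = xreg j" "j < length vals" using lvals by auto
    then have "\<rho> x \<in> set vals" by (simp add: \<rho>)
    \<comment> \<open>Gap positions go up to \<open>k\<close>, which is below \<open>n\<close>
      because \<open>0 < k\<close> and \<open>2 * k \<le> n\<close>.\<close>
    then show "\<rho> x < n" using le ab k by (force simp: vals_def)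
  qed
  moreover have "distinct ?xs" using inj_xreg by (simp add: distinct_map inj_on_def)
  ultimately have nest: "searches \<rho> (loop_nest ?xs (try_pair ?x ?qs ?y ?ss)) {}"
    using res by (intro searches_loop_nest) auto
  obtain r0 where r0: "r0 = (fst (init_state n k))(''B'' := k)" by blast
  have "search_inv (r0, \<lambda>_. 0)" by (simp add: search_inv_def r0 init_state_def)
  then have "wp c n (loop_nest ?xs (try_pair ?x ?qs ?y ?ss))
      (\<lambda>(r', h'). search_inv (r', h') \<and> r' ''f'' \<noteq> 0) (r0, \<lambda>_. 0)"
    using nest unfolding searches_def by (auto elim!: allE impE wp_mono)
  then have "wp c n (search_program d) (\<lambda>(r', h'). search_inv (r', h') \<and> r' ''f'' \<noteq> 0) (init_state n k)"
    unfolding search_program_def init_state_def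
    by (intro wp_Seq wp_Move) (simp add: r0 init_state_def)
  then obtain t r h where t: "exec c (search_program d) (init_state n k) t (r, h)"
      "t \<le> cost n (search_program d)" "search_inv (r, h)" "r ''f'' \<noteq> 0"
    by (auto simp: wp_def)
  \<comment> \<open>The exponent is \<open>4 * (d - 1)\<close> for the \<open>2 * (d - 1)\<close>
    loops, 8 for the body, and 1 to absorb the initial assignment.\<close>
  have "cost n (search_program d) \<le> n ^ (4 * d + 5)"
  proof -
    have "cost n (try_pair ?x ?qs ?y ?ss) \<le> n ^ 8"
      using d dn by (intro cost_try_pair) auto
    then have "cost n (search_program d) \<le> 1 + n ^ (2 * length ?xs + 8)"
      unfolding search_program_def using cost_loop_nest[of n _ 8 ?xs] dn d by simp
    also have "2 * length ?xs + 8 = 4 * d + 4" using d by simp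
    also have "1 + n ^ (4 * d + 4) \<le> 2 * n ^ (4 * d + 4)" using dn d by simp
    also have "\<dots> \<le> n * n ^ (4 * d + 4)" using dn d by (intro mult_right_mono) auto
    also have "\<dots> = n ^ (4 * d + 5)" by (simp add: eval_nat_numeral)
    finally show ?thesis .
  qed
  then have "t \<le> n ^ (4 * d + 5)" using t(2) by linarith
  moreover have "result_sets k (r, h) = (cells h 0 k, cells h k k)"
    "monochromatic_edge n k c (cells h 0 k) (cells h k k)"
    using t(3,4) by (auto simp: search_inv_def result_sets_def)
  ultimately show ?thesis
    unfolding finds_monochromatic_edge_def using t(1) by blast
qed

theorem theorem1p1:
  "\<exists>e :: nat \<Rightarrow> nat. (\<lambda>d. real (e d)) \<in> O(\<lambda>d. real d) \<and>
     (\<forall>d\<ge>2. \<exists>p :: program. \<forall>(m :: nat \<Rightarrow> nat \<Rightarrow> nat) n k c.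
        schrijver_instance m n k c \<longrightarrow> m n k < d * (n div (2 * k + d - 2)) \<longrightarrow>
        finds_monochromatic_edge p n k c (n ^ e d))"
proof (intro exI[of _ "\<lambda>d. 4 * d + 5"] conjI allI impI)
  show "(\<lambda>d. real (4 * d + 5)) \<in> O(\<lambda>d. real d)"
  proof (rule bigoI[of _ 9])
    show "\<forall>\<^sub>F d in sequentially. norm (real (4 * d + 5)) \<le> 9 * norm (real d)"
      using eventually_ge_at_top[of 1] by eventually_elim simp
  qed
  show "\<exists>p. \<forall>m n k c. schrijver_instance m n k c \<longrightarrow> m n k < d * (n div (2 * k + d - 2)) \<longrightarrow>
      finds_monochromatic_edge p n k c (n ^ (4 * d + 5))" if "2 \<le> d" for d
    using search_program_finds_edge[OF that] by blast
qed

end
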